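(* Suppose $0<d\le 1/2$ is constant and let $\theta=\ln d^{-1}$. For $H\in\mathcal{G}(n,d)$ and an integer $m$, let $G=H+R$, where $R$ is a uniformly random set of $m$ edges chosen from $\overline{E}=[n]^{(2)}\setminus E(H)$. (a) If $m\ge(30\theta+13)n$, then $G$ is Hamiltonian whp. (That is, for every choice of $H=H_n\in\mathcal{G}(n,d)$ and every $m=m(n)\ge(30\theta+13)n$, $G$ is Hamiltonian whp.) (b) If $d\le 1/10$, then there exist graphs $H=H_n\in\mathcal{G}(n,d)$ (one for each sufficiently large $n$) such that if $m=m(n)<\theta n/3$, then whp $G$ is not Hamiltonian.
   Context: Graphs are finite and simple. $[n]=\{1,\dots,n\}$ and $[n]^{(2)}$ is the set of all 2-element subsets of $[n]$. For a constant $0<d<1$, $\mathcal{G}(n,d)$ denotes the set of graphs with vertex set $[n]$ whose minimum degree is at least $dn$. For a graph $H$ on $[n]$ and a set $R$ of edges, $H+R$ is the graph on $[n]$ with edge set $E(H)\cup R$. It is implicit that $0\le m\le|\overline{E}|$, so that a set $R\subseteq\overline{E}$ with $|R|=m$ exists. A sequence of events $\mathcal{E}_n$ occurs "with high probability" (whp) if $\lim_{n\to\infty}\Pr(\mathcal{E}_n)=1$. A graph is Hamiltonian if it contains a cycle through all its vertices. *)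

theory Defs
  imports "HOL-Probability.Probability" "HOL-Library.Ramsey"
begin

text \<open>
  A finite simple graph on the vertex set \<open>{1..n}\<close> is identified with its edge set,
  a subset of \<open>nsets {1..n} 2\<close>.
\<close>

type_synonym edges = "nat set set"

definition degree :: "edges \<Rightarrow> nat \<Rightarrow> nat" where
  "degree E v = card {e \<in> E. v \<in> e}"

text \<open>\<open>Min {}\<close> is unspecified, so this is meaningful for \<open>n \<ge> 1\<close> only.\<close>

definition min_degree :: "nat \<Rightarrow> edges \<Rightarrow> nat" where
  "min_degree n E = Min (degree E ` {1..n})"

definition dense_graphs :: "nat \<Rightarrow> real \<Rightarrow> edges set" where
  "dense_graphs n d = {E. E \<subseteq> nsets {1..n} 2 \<and> d * real n \<le> real (min_degree n E)}"

definition non_edges :: "nat \<Rightarrow> edges \<Rightarrow> edges" where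
  "non_edges n E = nsets {1..n} 2 - E"

text \<open>A cycle is given by the list of its vertices, in order, without repeating the first one.\<close>

definition is_cycle :: "edges \<Rightarrow> nat list \<Rightarrow> bool" where
  "is_cycle E vs \<longleftrightarrow> 3 \<le> length vs \<and> distinct vs \<and>
     (\<forall>i < length vs. {vs ! i, vs ! (Suc i mod length vs)} \<in> E)"

definition hamiltonian :: "nat \<Rightarrow> edges \<Rightarrow> bool" where
  "hamiltonian n E \<longleftrightarrow> (\<exists>vs. is_cycle E vs \<and> set vs = {1..n})"

text \<open>
  The random graph \<open>H + R\<close>, with \<open>R\<close> uniform among the \<open>m\<close>-element sets of non-edges of \<open>H\<close>.
  Since \<open>pmf_of_set {}\<close> is unspecified, this requires \<open>m \<le> card (non_edges n H)\<close>.
\<close>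

definition random_augmentation :: "nat \<Rightarrow> edges \<Rightarrow> nat \<Rightarrow> edges pmf" where
  "random_augmentation n H m =
     map_pmf (\<lambda>R. H \<union> R) (pmf_of_set {R. R \<subseteq> non_edges n H \<and> card R = m})"

definition whp :: "(nat \<Rightarrow> 'a pmf) \<Rightarrow> (nat \<Rightarrow> 'a \<Rightarrow> bool) \<Rightarrow> bool" where
  "whp G P \<longleftrightarrow> (\<lambda>n. measure_pmf.prob (G n) {x. P n x}) \<longlonglongrightarrow> 1"

end

theory Submission
  imports Defs "HOL-Real_Asymp.Real_Asymp"
begin

text \<open>
  \<^bold>\<open>Hamiltonicity.\<close> The random edges are exposed in two rounds, the first of about
  \<open>(6 \<theta> + 11) n\<close> edges. After it, every nonempty vertex set \<open>S\<close> with at most \<open>n / 4\<close> elements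
  has at least \<open>2 |S|\<close> neighbours outside \<open>S\<close>. For \<open>|S| \<le> d n / 3\<close> the minimum degree of \<open>H\<close>
  already guarantees this. For a larger set of size \<open>s\<close> a failure requires a set \<open>T\<close> of size \<open>2 s\<close>
  such that no edge, random or not, joins \<open>S\<close> to the at least \<open>n / 4\<close> vertices outside \<open>S \<union> T\<close>; there
  are at most \<open>exp (3 \<theta> s + O(s))\<close> choices for \<open>(S, T)\<close>, because \<open>n / s < 3 / d\<close>, and each of them
  survives with probability at most \<open>exp (- (6 \<theta> + 11) s / 2)\<close>, so the union bound works
  (\<open>expansion_fails_rarely\<close>).

  An expanding graph on at least ten vertices is connected, and by Posa's rotation lemma
  (\<open>posa\<close>) a longest path in it can be rotated so as to have more than \<open>n / 4\<close> different ends, with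
  either of its two ends kept fixed. Hence at least \<open>n\<^sup>2 / 32\<close> non-edges are boosters: joining the ends of
  a longest path closes a cycle, which is Hamiltonian or extends to a longer path by
  connectivity (\<open>many_boosters\<close>). There are at most \<open>n\<^sup>2 / 2\<close> non-edges, so each edge of the second
  round is a booster with probability at least \<open>1/16\<close> as long as the graph is not Hamiltonian.
  About \<open>n\<close> boosters suffice and the second round has at least \<open>18 n - 1\<close> edges; the deviation is
  controlled by an exponential potential (\<open>few_failures\<close>).

  \<^bold>\<open>Non-Hamiltonicity.\<close> Take for \<open>H\<close> the complete bipartite graph with sides of size \<open>a\<close>, about
  \<open>d n\<close>, and \<open>n - a\<close>. A vertex of the larger side that meets no random edge has all its neighbours on the
  smaller side, so on a Hamiltonian cycle its successor is there, and a Hamiltonian cycle leaves room for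
  at most \<open>a\<close> such vertices. With fewer than \<open>\<theta> n / 3\<close> random edges, a vertex of the larger side
  is untouched with probability at least \<open>exp (- (9/10) \<theta>) = d powr (9/10)\<close>, so the expected number
  of untouched vertices exceeds \<open>d n\<close> by a linear amount, and the second moment method shows
  that with high probability there are more than \<open>a\<close> of them (\<open>few_untouched_rare\<close>).

  Probabilities under a uniform \<open>m\<close>-subset are handled throughout as cardinalities of families
  of \<open>m\<close>-subsets, compared with \<open>N choose m\<close>.
\<close>

section \<open>Paths, rotations and Posa's lemma\<close>

definition nbhd :: "edges \<Rightarrow> nat set \<Rightarrow> nat set" where
  "nbhd E S = {w. w \<notin> S \<and> (\<exists>u\<in>S. {u, w} \<in> E)}"

text \<open>
  With the edges of a path collected in a set, that a rotation replaces one edge of the path by another becomes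
  a statement about sets, and reversal does not change anything.
\<close>

fun path_edges :: "nat list \<Rightarrow> edges" where
  "path_edges (x # y # zs) = insert {x, y} (path_edges (y # zs))"
| "path_edges _ = {}"

definition is_path :: "nat \<Rightarrow> edges \<Rightarrow> nat list \<Rightarrow> bool" where
  "is_path n E vs \<longleftrightarrow> vs \<noteq> [] \<and> distinct vs \<and> set vs \<subseteq> {1..n} \<and> path_edges vs \<subseteq> E"

lemma path_edges_append:
  "path_edges (xs @ ys) = path_edges xs \<union> path_edges ys \<union>
     (if xs = [] \<or> ys = [] then {} else {{last xs, hd ys}})"
proof (induction xs rule: path_edges.induct)
  case ("2_2" v)
  show ?case by (cases ys) auto
qed auto

lemma path_edges_Cons:
  "path_edges (x # ys) = path_edges ys \<union> (if ys = [] then {} else {{x, hd ys}})"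
  by (cases ys) auto

lemma path_edges_rev: "path_edges (rev xs) = path_edges xs"
  by (induction xs) (auto simp: path_edges_append path_edges_Cons last_rev insert_commute)

lemma path_edges_subset: "e \<in> path_edges xs \<Longrightarrow> e \<subseteq> set xs"
  by (induction xs rule: path_edges.induct) auto

lemma nth_path_edges: "Suc i < length xs \<Longrightarrow> {xs ! i, xs ! Suc i} \<in> path_edges xs"
proof (induction xs arbitrary: i)
  case (Cons x xs) then show ?case
    by (cases i) (auto simp: path_edges_Cons hd_conv_nth)
qed simp

text \<open>
  The operation of Posa: if the last vertex is adjacent to a vertex \<open>v\<close> of the path, the part after \<open>v\<close> can
  be reversed. The first vertex never changes.
\<close>

inductive rotation :: "edges \<Rightarrow> nat list \<Rightarrow> nat list \<Rightarrow> bool" for E P where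
  start: "rotation E P P"
| step: "rotation E P (as @ v # bs) \<Longrightarrow> bs \<noteq> [] \<Longrightarrow> {v, last bs} \<in> E
          \<Longrightarrow> rotation E P (as @ v # rev bs)"

definition rotation_ends :: "edges \<Rightarrow> nat list \<Rightarrow> nat set" where
  "rotation_ends E P = {last Q | Q. rotation E P Q}"

lemma rotation_set: "rotation E P Q \<Longrightarrow> set Q = set P \<and> length Q = length P"
  by (induction rule: rotation.induct) auto

lemma rotation_hd: "rotation E P Q \<Longrightarrow> P \<noteq> [] \<Longrightarrow> hd Q = hd P"
  by (induction rule: rotation.induct) (auto simp: hd_append split: if_splits)

lemma rotation_is_path: "rotation E P Q \<Longrightarrow> is_path n E P \<Longrightarrow> is_path n E Q"
proof (induction rule: rotation.induct)
  case (step as v bs)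
  then show ?case
    by (auto simp: is_path_def path_edges_append path_edges_Cons path_edges_rev hd_rev split: if_splits)
qed

text \<open>
  A rotation at \<open>v\<close> removes only the edge from \<open>v\<close> to its successor, and that successor is the new end.
\<close>

lemma rotation_keeps_edges:
  assumes "rotation E P Q" "e \<in> path_edges P" "e \<inter> rotation_ends E P = {}"
  shows "e \<in> path_edges Q"
  using assms(1)
proof (induction rule: rotation.induct)
  case (step as v bs)
  have "rotation E P (as @ v # rev bs)" using step.hyps by (intro rotation.step)
  then have "hd bs \<in> rotation_ends E P" unfolding rotation_ends_def
    using \<open>bs \<noteq> []\<close> by (intro CollectI exI[of _ "as @ v # rev bs"]) (simp add: last_rev)
  then have "e \<noteq> {v, hd bs}" using assms(3) by auto
  then show ?case using step.IH \<open>bs \<noteq> []\<close>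
    by (auto simp: path_edges_append path_edges_Cons path_edges_rev split: if_splits)
qed (use assms in auto)

lemma path_edges_neighbour:
  assumes "distinct (as @ w # bs)" "{w, z} \<in> path_edges (as @ w # bs)"
  shows "(bs \<noteq> [] \<and> z = hd bs) \<or> (as \<noteq> [] \<and> z = last as)"
  using assms path_edges_subset[of "{w,z}" as] path_edges_subset[of "{w,z}" bs]
  by (auto simp: path_edges_append path_edges_Cons doubleton_eq_iff split: if_splits)

lemma rotation_ends_subset: "P \<noteq> [] \<Longrightarrow> rotation_ends E P \<subseteq> set P"
  unfolding rotation_ends_def
  by clarsimp (metis rotation_set last_in_set list.set_intros(1) length_0_conv)

text \<open>
  Posa's lemma. A neighbour of an end \<open>u\<close> lies on the path, for otherwise the path would not be longest. If it
  is not an end itself, then one of its neighbours on the original path is: otherwise every path edge at it would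
  survive all rotations, and rotating at it would make one of those neighbours an end. So the outer
  neighbourhood of the set of ends is covered by the path neighbours of ends.
\<close>

lemma posa:
  assumes P: "is_path n E P" and longest: "\<And>Q. is_path n E Q \<Longrightarrow> length Q \<le> length P"
    and E: "E \<subseteq> nsets {1..n} 2"
  shows "card (nbhd E (rotation_ends E P)) < 2 * card (rotation_ends E P)"
proof -
  define S where "S = rotation_ends E P"
  have ne: "P \<noteq> []" and dP: "distinct P" using P by (auto simp: is_path_def)
  have S: "S \<subseteq> set P" unfolding S_def using rotation_ends_subset[OF ne] .
  have lastS: "last P \<in> S" unfolding S_def rotation_ends_def using rotation.start by blast
  have key: "\<exists>i. Suc i < length P \<and> ((w = P ! i \<and> P ! Suc i \<in> S) \<or> (w = P ! Suc i \<and> P ! i \<in> S))"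
    if w: "w \<in> nbhd E S" for w
  proof (rule ccontr)
    assume neg: "\<not> ?thesis"
    from w obtain u where wS: "w \<notin> S" and "u \<in> S" and uw: "{u, w} \<in> E" by (auto simp: nbhd_def)
    then obtain Q where Q: "rotation E P Q" and u: "u = last Q"
      by (auto simp: S_def rotation_ends_def)
    have pQ: "is_path n E Q" by (rule rotation_is_path[OF Q P])
    have wV: "w \<in> {1..n}" using uw E by (auto simp: nsets_def)
    have "w \<in> set Q"
    proof (rule ccontr)
      assume "w \<notin> set Q"
      then have "is_path n E (Q @ [w])"
        using pQ uw wV u by (auto simp: is_path_def path_edges_append)
      then show False using longest[of "Q @ [w]"] rotation_set[OF Q] by simp
    qed
    then obtain as bs where Qs: "Q = as @ w # bs" by (meson split_list)
    have bs: "bs \<noteq> []" using wS \<open>u \<in> S\<close> u Qs by auto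
    have "rotation E P (as @ w # rev bs)"
      using Q Qs bs uw u by (intro rotation.step) (auto simp: insert_commute)
    then have hdS: "hd bs \<in> S" unfolding S_def rotation_ends_def
      using bs by (intro CollectI exI[of _ "as @ w # rev bs"]) (simp add: last_rev)
    have dQ: "distinct (as @ w # bs)" using pQ Qs by (simp add: is_path_def)
    have "w \<in> set P" using \<open>w \<in> set Q\<close> rotation_set[OF Q] by simp
    then obtain i where i: "i < length P" "w = P ! i" by (metis in_set_conv_nth)
    have "Suc i < length P"
    proof (rule ccontr)
      assume "\<not> ?thesis"
      then have "length P - 1 = i" using i by simp
      then have "w = last P" using i ne by (simp add: last_conv_nth)
      then show False using lastS wS by simp
    qed
    then have s: "P ! Suc i \<notin> S" using neg i by auto
    have keep: "e \<in> path_edges Q" if "e \<in> path_edges P" "e \<inter> S = {}" for e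
      using rotation_keeps_edges[OF Q] that by (auto simp: S_def)
    have e1: "{w, P ! Suc i} \<in> path_edges (as @ w # bs)"
      using keep[OF nth_path_edges[OF \<open>Suc i < length P\<close>]] s wS i Qs by auto
    from path_edges_neighbour[OF dQ e1] s hdS have as: "as \<noteq> []" "P ! Suc i = last as" by auto
    \<comment> \<open>The path neighbours of \<open>w\<close> lie outside \<open>S\<close>, so they are still next to \<open>w\<close> in \<open>Q\<close>; but one of the
        places next to \<open>w\<close> in \<open>Q\<close> is taken by \<open>hd bs\<close>, which rotating at \<open>w\<close> turns into an end.\<close>
    show False
    proof (cases i)
      case 0
      then have "w = hd P" using i ne by (simp add: hd_conv_nth)
      then have "w = hd as" using rotation_hd[OF Q ne] Qs as by simp
      then show False using dQ as by (cases as) auto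
    next
      case (Suc j)
      then have s2: "P ! j \<notin> S" using neg i by auto
      have e2: "{w, P ! j} \<in> path_edges (as @ w # bs)"
        using keep[OF nth_path_edges[of j P]] s2 wS i Qs Suc by (auto simp: insert_commute)
      from path_edges_neighbour[OF dQ e2] s2 hdS have "P ! j = last as" by auto
      then have "P ! j = P ! Suc i" using as by simp
      then show False using dP Suc \<open>Suc i < length P\<close> by (simp add: nth_eq_iff_index_eq)
    qed
  qed
  \<comment> \<open>A vertex has at most two path neighbours, and \<open>last P\<close>, which is an end, has at most one: hence
      the strict inequality.\<close>
  define J where "J = {j. j < length P \<and> P ! j \<in> S}"
  have finJ: "finite J" by (simp add: J_def)
  have "bij_betw ((!) P) J S"
    unfolding bij_betw_def J_def
  proof
    show "inj_on ((!) P) {j. j < length P \<and> P ! j \<in> S}"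
      using dP by (auto simp: inj_on_def nth_eq_iff_index_eq)
    show "(!) P ` {j. j < length P \<and> P ! j \<in> S} = S"
      using S by (force simp: in_set_conv_nth subset_iff)
  qed
  then have cJ: "card J = card S" by (rule bij_betw_same_card)
  have lJ: "length P - 1 \<in> J" using ne lastS by (simp add: J_def last_conv_nth)
  have "nbhd E S \<subseteq> (\<lambda>j. P ! (j - 1)) ` J \<union> (\<lambda>j. P ! Suc j) ` (J - {length P - 1})"
  proof
    fix w assume "w \<in> nbhd E S"
    from key[OF this] obtain i where i: "Suc i < length P"
      and "(w = P ! i \<and> P ! Suc i \<in> S) \<or> (w = P ! Suc i \<and> P ! i \<in> S)" by blast
    then consider "w = P ! i" "Suc i \<in> J" | "w = P ! Suc i" "i \<in> J - {length P - 1}"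
      by (auto simp: J_def)
    then show "w \<in> (\<lambda>j. P ! (j - 1)) ` J \<union> (\<lambda>j. P ! Suc j) ` (J - {length P - 1})"
    proof cases
      case 1 then have "w = (\<lambda>j. P ! (j - 1)) (Suc i)" by simp
      then show ?thesis using 1 by blast
    qed auto
  qed
  then have "card (nbhd E S) \<le> card ((\<lambda>j. P ! (j - 1)) ` J \<union> (\<lambda>j. P ! Suc j) ` (J - {length P - 1}))"
    using finJ by (intro card_mono) auto
  also have "\<dots> \<le> card J + card (J - {length P - 1})"
    using finJ by (intro order.trans[OF card_Un_le] add_mono card_image_le) auto
  also have "\<dots> < 2 * card J"
  proof -
    have "card (J - {length P - 1}) < card J" using lJ finJ by (rule card_Diff1_less[rotated])
    then show ?thesis by simp
  qed
  finally show ?thesis using cJ by (simp add: S_def)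
qed

section \<open>Boosters in expanding graphs\<close>

definition expands :: "nat \<Rightarrow> edges \<Rightarrow> bool" where
  "expands n E \<longleftrightarrow> (\<forall>S. S \<subseteq> {1..n} \<and> S \<noteq> {} \<and> 4 * card S \<le> n \<longrightarrow> 2 * card S \<le> card (nbhd E S))"

lemma nbhd_mono: "E \<subseteq> F \<Longrightarrow> nbhd E S \<subseteq> nbhd F S"
  by (auto simp: nbhd_def)

lemma nbhd_subset: "E \<subseteq> nsets {1..n} 2 \<Longrightarrow> nbhd E S \<subseteq> {1..n}"
  by (auto simp: nbhd_def nsets_def)

lemma finite_nbhd: "E \<subseteq> nsets {1..n} 2 \<Longrightarrow> finite (nbhd E S)"
  using finite_subset[OF nbhd_subset] by simp

lemma expands_mono:
  assumes "expands n E" "E \<subseteq> F" "F \<subseteq> nsets {1..n} 2"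
  shows "expands n F"
proof -
  have "card (nbhd E S) \<le> card (nbhd F S)" for S
    by (rule card_mono[OF finite_nbhd[OF assms(3)] nbhd_mono[OF assms(2)]])
  then show ?thesis using assms(1) unfolding expands_def by (meson order.trans)
qed

lemma hamiltonian_mono: "hamiltonian n E \<Longrightarrow> E \<subseteq> F \<Longrightarrow> hamiltonian n F"
  unfolding hamiltonian_def is_cycle_def by (meson subsetD)

lemma finite_non_edges: "finite (non_edges n E)"
  unfolding non_edges_def by (simp add: finite_imp_finite_nsets)

lemma card_non_edges_le: "2 * card (non_edges n E) \<le> n\<^sup>2"
proof -
  have "card (non_edges n E) \<le> card (nsets {1..n} 2)"
    unfolding non_edges_def by (intro card_mono) (auto simp: finite_imp_finite_nsets)
  also have "\<dots> = n choose 2" by simp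
  finally have "2 * card (non_edges n E) \<le> 2 * (n choose 2)" by simp
  also have "\<dots> \<le> n * n" by (simp add: choose_two) (meson diff_le_self dual_order.trans mult_le_mono2 times_div_less_eq_dividend)
  finally show ?thesis by (simp add: power2_eq_square)
qed

lemma expands_leaves_small_set:
  assumes n: "10 \<le> n" and E: "E \<subseteq> nsets {1..n} 2" and ex: "expands n E"
    and U: "U \<subseteq> {1..n}" "U \<noteq> {}" "2 * card U \<le> n"
  shows "nbhd E U \<noteq> {}"
proof
  assume no: "nbhd E U = {}"
  have finU: "finite U" using U(1) finite_subset by blast
  have "card U > 0" using finU U by (simp add: card_gt_0_iff)
  show False
  proof (cases "4 * card U \<le> n")
    case True
    then have "2 * card U \<le> card (nbhd E U)" using ex U by (auto simp: expands_def)
    then show False using no \<open>card U > 0\<close> by simp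
  next
    case False
    \<comment> \<open>A subset of \<open>U\<close> of the largest size to which expansion applies has its neighbours in \<open>U\<close> too,
        so \<open>U\<close> would contain about \<open>3 n / 4\<close> vertices.\<close>
    define k where "k = n div 4"
    have "k \<le> card U" using False by (simp add: k_def)
    then obtain S where S: "S \<subseteq> U" "card S = k" "finite S" by (rule obtain_subset_with_card_n)
    have "S \<noteq> {}" using S n by (auto simp: k_def)
    moreover have "S \<subseteq> {1..n}" "4 * card S \<le> n" using S U(1) by (auto simp: k_def)
    ultimately have "2 * card S \<le> card (nbhd E S)" using ex by (simp add: expands_def)
    also have "nbhd E S \<subseteq> U - S" using no S by (auto simp: nbhd_def)
    then have "card (nbhd E S) \<le> card U - card S"
      using finU S card_mono[of "U - S" "nbhd E S"] card_Diff_subset[of S U] by simp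
    finally have "3 * k \<le> card U" using S \<open>k \<le> card U\<close> by simp
    then show False using U(3) n by (simp add: k_def)
  qed
qed

text \<open>
  One of \<open>W\<close> and its complement has at most half of the vertices, and such a set has an outer neighbour.
\<close>

lemma expands_connected:
  assumes n: "10 \<le> n" and E: "E \<subseteq> nsets {1..n} 2" and ex: "expands n E"
    and W: "W \<subseteq> {1..n}" "W \<noteq> {}" "W \<noteq> {1..n}"
  shows "\<exists>w\<in>W. \<exists>u\<in>{1..n} - W. {w, u} \<in> E"
proof -
  have c: "card ({1..n} - W) = n - card W" "card W \<le> n"
    using W finite_subset[OF W(1)] card_mono[OF _ W(1)] by (auto simp: card_Diff_subset)
  consider "2 * card W \<le> n" | "2 * card ({1..n} - W) \<le> n" using c by linarith
  then show ?thesis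
  proof cases
    case 1
    from expands_leaves_small_set[OF n E ex W(1,2) 1] show ?thesis
      using nbhd_subset[OF E, of W] by (fastforce simp: nbhd_def)
  next
    case 2
    have "{1..n} - W \<noteq> {}" using W by blast
    from expands_leaves_small_set[OF n E ex _ this 2]
    obtain w where "w \<in> nbhd E ({1..n} - W)" by blast
    then obtain u where "w \<notin> {1..n} - W" "u \<in> {1..n} - W" "{u, w} \<in> E"
      unfolding nbhd_def by blast
    moreover have "w \<in> {1..n}" using \<open>{u, w} \<in> E\<close> E by (auto simp: nsets_def)
    ultimately show ?thesis by (metis Diff_iff insert_commute)
  qed
qed

lemma is_path_mono: "is_path n E P \<Longrightarrow> E \<subseteq> F \<Longrightarrow> is_path n F P"
  by (auto simp: is_path_def)

lemma is_path_rev: "is_path n E P \<Longrightarrow> is_path n E (rev P)"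
  by (simp add: is_path_def path_edges_rev)

lemma is_path_length: "is_path n E P \<Longrightarrow> length P \<le> n"
  unfolding is_path_def by (metis card_atLeastAtMost card_mono diff_Suc_1 distinct_card finite_atLeastAtMost)

lemma exists_longest_path:
  assumes "1 \<le> n"
  obtains P where "is_path n E P" "\<And>Q. is_path n E Q \<Longrightarrow> length Q \<le> length P"
proof -
  have "is_path n E [1]" using assms by (simp add: is_path_def)
  then have "\<exists>P. is_path n E P \<and> (\<forall>Q. is_path n E Q \<longrightarrow> length Q \<le> length P)"
    by (rule ex_has_greatest_nat[where b = "Suc n"]) (simp add: less_Suc_eq_le is_path_length)
  then show ?thesis using that by blast
qed

lemma hamiltonian_if_closed_path:
  assumes "is_path n E vs" "length vs = n" "3 \<le> n" "{last vs, hd vs} \<in> E"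
  shows "hamiltonian n E"
proof -
  have d: "distinct vs" and ne: "vs \<noteq> []" using assms by (auto simp: is_path_def)
  have "set vs = {1..n}"
    using assms d by (intro card_subset_eq) (auto simp: is_path_def distinct_card)
  moreover have "{vs ! i, vs ! (Suc i mod length vs)} \<in> E" if i: "i < length vs" for i
  proof (cases "Suc i < length vs")
    case True
    then show ?thesis using nth_path_edges[OF True] assms(1) by (auto simp: is_path_def)
  next
    case False
    then have "Suc i = length vs" using i by simp
    then show ?thesis using assms(4) ne
      by (metis diff_Suc_1 hd_conv_nth last_conv_nth mod_self)
  qed
  ultimately show ?thesis using assms d by (auto simp: hamiltonian_def is_cycle_def)
qed

text \<open>
  The cycle is cut open at \<open>w\<close> and entered from \<open>u\<close>.
\<close>

lemma path_extension_closed: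
  assumes P: "is_path n E vs" and w: "w \<in> set vs" and u: "u \<notin> set vs" "u \<in> {1..n}"
    and uw: "{w, u} \<in> E" and cl: "{last vs, hd vs} \<in> E"
  shows "\<exists>us. is_path n E us \<and> length us = Suc (length vs)"
proof -
  obtain as bs where vs: "vs = as @ w # bs" using w by (meson split_list)
  have "is_path n E (u # w # bs @ as)"
    using P u uw cl unfolding vs is_path_def
    by (auto simp: path_edges_append path_edges_Cons insert_commute split: if_splits)
  then show ?thesis by (intro exI) (auto simp: vs)
qed

lemma rotation_ends_large:
  assumes "expands n E" "E \<subseteq> nsets {1..n} 2" "is_path n E P"
    and "\<And>Q. is_path n E Q \<Longrightarrow> length Q \<le> length P"
  shows "n < 4 * card (rotation_ends E P)"
proof (rule ccontr)
  assume "\<not> ?thesis"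
  moreover have "rotation_ends E P \<subseteq> {1..n}" "rotation_ends E P \<noteq> {}"
    using assms(3) rotation_ends_subset[of P E] rotation.start[of E P]
    by (auto simp: is_path_def rotation_ends_def)
  ultimately have "2 * card (rotation_ends E P) \<le> card (nbhd E (rotation_ends E P))"
    using assms(1) by (simp add: expands_def)
  then show False using posa[OF assms(3,4,2)] by simp
qed

text \<open>
  For a graph whose longest paths have \<open>l\<close> vertices, this is what a booster achieves.
\<close>

definition improves :: "nat \<Rightarrow> edges \<Rightarrow> nat \<Rightarrow> bool" where
  "improves n E l \<longleftrightarrow> hamiltonian n E \<or> (\<exists>Q. is_path n E Q \<and> length Q = Suc l)"

lemma closed_path_improves:
  assumes n: "10 \<le> n" and E: "E \<subseteq> nsets {1..n} 2" and ex: "expands n E"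
    and Q: "is_path n E Q" and closed: "{last Q, hd Q} \<in> E"
  shows "improves n E (length Q)"
proof (cases "length Q = n")
  case True
  then show ?thesis using hamiltonian_if_closed_path[OF Q True _ closed] n by (simp add: improves_def)
next
  case False
  have dQ: "distinct Q" "set Q \<noteq> {}" "set Q \<subseteq> {1..n}" using Q by (auto simp: is_path_def)
  then have "set Q \<noteq> {1..n}" using False distinct_card[of Q] by auto
  from expands_connected[OF n E ex dQ(3,2) this] obtain w u
    where "w \<in> set Q" "u \<in> {1..n}" "u \<notin> set Q" "{w, u} \<in> E" by blast
  then show ?thesis
    using path_extension_closed[OF Q _ _ _ _ closed] by (auto simp: improves_def)
qed

lemma many_boosters:
  assumes n: "10 \<le> n" and E: "E \<subseteq> nsets {1..n} 2" and ex: "expands n E"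
    and nh: "\<not> hamiltonian n E"
    and P: "is_path n E P" and longest: "\<And>Q. is_path n E Q \<Longrightarrow> length Q \<le> length P"
  shows "n\<^sup>2 \<le> 32 * card {e \<in> non_edges n E. improves n (insert e E) (length P)}"
proof -
  \<comment> \<open>\<open>D\<close> is the set of ordered pairs of ends of longest paths. Fixing either end and rotating the
      other gives more than \<open>n / 4\<close> choices each time, and every pair is a booster.\<close>
  define B where "B = {e \<in> non_edges n E. improves n (insert e E) (length P)}"
  define D where "D = {(a, b). \<exists>Q. is_path n E Q \<and> length Q = length P \<and> hd Q = a \<and> last Q = b}"
  have large: "n < 4 * card (rotation_ends E Q)" if "is_path n E Q" "length Q = length P" for Q
    using rotation_ends_large[OF ex E that(1)] longest that(2) by simp
  have endsV: "rotation_ends E Q \<subseteq> {1..n}" if "is_path n E Q" for Q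
    using that rotation_ends_subset[of Q E] by (auto simp: is_path_def)
  have "hd Q \<in> {1..n} \<and> last Q \<in> {1..n}" if "is_path n E Q" for Q
    using that unfolding is_path_def by (meson hd_in_set last_in_set subsetD)
  then have DV: "D \<subseteq> {1..n} \<times> {1..n}" by (auto simp: D_def)
  then have finD: "finite D" by (rule finite_subset) simp
  have finD': "finite {b. (y, b) \<in> D}" for y
    by (rule finite_subset[of _ "{1..n}"]) (use DV in auto)
  have DB: "{a, b} \<in> B" "a \<noteq> b" if "(a, b) \<in> D" for a b
  proof -
    from that obtain Q where Q: "is_path n E Q" "length Q = length P" "hd Q = a" "last Q = b"
      by (auto simp: D_def)
    have V: "a \<in> {1..n}" "b \<in> {1..n}" using Q by (auto simp: is_path_def subset_iff)
    have "card (rotation_ends E Q) \<le> card (set Q)"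
      using Q by (intro card_mono rotation_ends_subset) (auto simp: is_path_def)
    then have "2 \<le> length Q" using large[OF Q(1,2)] card_length[of Q] n by linarith
    then show "a \<noteq> b" using Q(1,3,4)
      by (cases Q) (auto simp: is_path_def split: if_splits)
    then have e: "{a, b} \<in> nsets {1..n} 2" using V by (auto simp: nsets_def)
    have "improves n F (length P)" if "F \<subseteq> nsets {1..n} 2" "E \<subseteq> F" "{a, b} \<in> F" for F
      using closed_path_improves[OF n that(1) expands_mono[OF ex that(2,1)] is_path_mono[OF Q(1) that(2)]]
        that(3) Q by (simp add: insert_commute)
    \<comment> \<open>The instance \<open>F = E\<close> shows that the pair is not an edge yet, the other that it is a booster.\<close>
    from this[of "insert {a, b} E"] this[of E] e E nh longest show "{a, b} \<in> B"
      by (fastforce simp: B_def non_edges_def improves_def)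
  qed
  have "(SIGMA y:rotation_ends E P. {b. (y, b) \<in> D}) \<subseteq> D" by auto
  then have "(\<Sum>y\<in>rotation_ends E P. card {b. (y, b) \<in> D}) \<le> card D"
    using card_mono[OF finD] finD' finite_subset[OF endsV[OF P]]
    by (simp flip: card_SigmaI)
  moreover have "n \<le> 4 * card {b. (y, b) \<in> D}" if "y \<in> rotation_ends E P" for y
  proof -
    from that obtain Q where Q: "rotation E P Q" "y = last Q" by (auto simp: rotation_ends_def)
    have pQ: "is_path n E (rev Q)" by (intro is_path_rev rotation_is_path[OF Q(1) P])
    have l: "length (rev Q) = length P" using rotation_set[OF Q(1)] by simp
    have "rotation_ends E (rev Q) \<subseteq> {b. (y, b) \<in> D}"
    proof
      fix b assume "b \<in> rotation_ends E (rev Q)"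
      then obtain T where T: "rotation E (rev Q) T" "b = last T" by (auto simp: rotation_ends_def)
      have "hd T = y" using rotation_hd[OF T(1)] pQ Q(2) by (simp add: is_path_def hd_rev)
      then show "b \<in> {b. (y, b) \<in> D}" using rotation_is_path[OF T(1) pQ] rotation_set[OF T(1)] l T(2)
        by (auto simp: D_def)
    qed
    then have "card (rotation_ends E (rev Q)) \<le> card {b. (y, b) \<in> D}"
      using finD' by (intro card_mono)
    then show ?thesis using large[OF pQ l] by simp
  qed
  then have "(\<Sum>y\<in>rotation_ends E P. n) \<le> (\<Sum>y\<in>rotation_ends E P. 4 * card {b. (y, b) \<in> D})"
    by (rule sum_mono)
  ultimately have "card (rotation_ends E P) * n \<le> 4 * card D"
    by (simp flip: sum_distrib_left)
  moreover have "n * n \<le> (4 * card (rotation_ends E P)) * n"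
    using large[OF P] by (intro mult_right_mono) auto
  ultimately have "n\<^sup>2 \<le> 16 * card D" unfolding power2_eq_square mult.assoc by linarith
  also have "card D \<le> 2 * card B"
  proof -
    have finB: "finite B" using finite_non_edges by (simp add: B_def)
    have "D \<subseteq> (\<Union>e\<in>B. {(a, b). a \<noteq> b \<and> {a, b} = e})" using DB by auto
    moreover have two: "finite {(a, b). a \<noteq> b \<and> {a, b} = e} \<and> card {(a, b). a \<noteq> b \<and> {a, b} = e} \<le> 2"
      for e :: "nat set"
    proof (cases "\<exists>a b. e = {a, b}")
      case True
      then obtain a b where "e = {a, b}" by blast
      then have sub: "{(a, b). a \<noteq> b \<and> {a, b} = e} \<subseteq> {(a, b), (b, a)}" by (auto simp: doubleton_eq_iff)
      then show ?thesis using card_mono[OF _ sub] finite_subset[OF sub]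
        by (auto intro: order.trans[OF _ card_insert_le_m1] split: if_splits)
    next
      case False
      then have "{(a, b). a \<noteq> b \<and> {a, b} = e} = {}" by auto
      then show ?thesis by (metis card.empty finite.emptyI zero_le)
    qed
    ultimately have "card D \<le> card (\<Union>e\<in>B. {(a, b). a \<noteq> b \<and> {a, b} = e})"
      using finB by (intro card_mono) auto
    also have "\<dots> \<le> (\<Sum>e\<in>B. card {(a, b). a \<noteq> b \<and> {a, b} = e})" by (rule card_UN_le[OF finB])
    also have "\<dots> \<le> (\<Sum>e\<in>B. 2)" using two by (intro sum_mono) blast
    finally show ?thesis by simp
  qed
  finally show ?thesis by (simp add: B_def)
qed

section \<open>Counting subsets of a given size\<close>

lemma finite_subsets_of_size: "finite U \<Longrightarrow> finite {R. R \<subseteq> U \<and> card R = m \<and> Q R}"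
  by (rule finite_subset[of _ "Pow U"]) auto

text \<open>
  A uniform \<open>(k + l)\<close>-subset may be drawn as a uniform \<open>k\<close>-subset followed by a uniform \<open>l\<close>-subset of the rest:
  both sides count the pairs of a \<open>(k + l)\<close>-set satisfying \<open>Q\<close> and a \<open>k\<close>-subset of it.
\<close>

lemma two_step_count:
  assumes U: "finite (U :: 'a set)"
  shows "(k + l choose k) * card {R. R \<subseteq> U \<and> card R = k + l \<and> Q R}
       = (\<Sum>A | A \<subseteq> U \<and> card A = k. card {B. B \<subseteq> U - A \<and> card B = l \<and> Q (A \<union> B)})"
proof -
  let ?X = "SIGMA R:{R. R \<subseteq> U \<and> card R = k + l \<and> Q R}. {A. A \<subseteq> R \<and> card A = k}"
  let ?Y = "SIGMA A:{A. A \<subseteq> U \<and> card A = k}. {B. B \<subseteq> U - A \<and> card B = l \<and> Q (A \<union> B)}"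
  have fin: "finite A" if "A \<subseteq> U" for A using that U finite_subset by blast
  have "card ?X = card ?Y"
  proof (rule bij_betw_same_card)
    have cD: "A \<subseteq> U \<and> R - A \<subseteq> U - A \<and> card (R - A) = l" if "R \<subseteq> U" "card R = k + l" "A \<subseteq> R" "card A = k" for R A
      using that card_Diff_subset[of A R] fin[of A] by auto
    have cU: "A \<union> B \<subseteq> U \<and> card (A \<union> B) = k + l" if "A \<subseteq> U" "card A = k" "B \<subseteq> U - A" "card B = l" for A B
      using that card_Un_disjoint[of A B] fin[of A] fin[of B] by auto
    show "bij_betw (\<lambda>(R, A). (A, R - A)) ?X ?Y"
    proof (rule bij_betw_byWitness[where f' = "\<lambda>(A, B). (A \<union> B, A)"])
      show "(\<lambda>(R, A). (A, R - A)) ` ?X \<subseteq> ?Y"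
      proof
        fix p assume "p \<in> (\<lambda>(R, A). (A, R - A)) ` ?X"
        then obtain R A where p: "p = (A, R - A)" and "R \<subseteq> U" "card R = k + l" "Q R" "A \<subseteq> R" "card A = k"
          by auto
        then show "p \<in> ?Y" using cD[of R A] by (simp add: Un_absorb1)
      qed
      show "(\<lambda>(A, B). (A \<union> B, A)) ` ?Y \<subseteq> ?X"
      proof
        fix p assume "p \<in> (\<lambda>(A, B). (A \<union> B, A)) ` ?Y"
        then obtain A B where p: "p = (A \<union> B, A)" and "A \<subseteq> U" "card A = k" "B \<subseteq> U - A" "card B = l" "Q (A \<union> B)"
          by auto
        then show "p \<in> ?X" using cU[of A B] by simp
      qed
    qed auto
  qed
  moreover have "card ?X = (\<Sum>R | R \<subseteq> U \<and> card R = k + l \<and> Q R. k + l choose k)"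
    using U by (subst card_SigmaI) (auto simp: finite_subsets_of_size n_subsets fin intro!: sum.cong)
  moreover have "card ?Y = (\<Sum>A | A \<subseteq> U \<and> card A = k. card {B. B \<subseteq> U - A \<and> card B = l \<and> Q (A \<union> B)})"
    using U finite_subsets_of_size[OF U, of k "\<lambda>_. True"]
    by (subst card_SigmaI) (auto intro!: finite_subsets_of_size)
  ultimately show ?thesis by (simp add: mult.commute)
qed

lemma one_step_count:
  assumes U: "finite (U :: 'a set)"
  shows "Suc m * card {R. R \<subseteq> U \<and> card R = Suc m \<and> Q R}
       = (\<Sum>e\<in>U. card {B. B \<subseteq> U - {e} \<and> card B = m \<and> Q (insert e B)})"
proof -
  have "{A. A \<subseteq> U \<and> card A = 1} = (\<lambda>e. {e}) ` U" by (auto simp: card_1_singleton_iff)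
  then show ?thesis using two_step_count[OF U, of 1 m Q]
    by (simp add: sum.reindex)
qed

lemma card_avoiding:
  assumes "finite U" "F \<subseteq> U"
  shows "card {R. R \<subseteq> U \<and> card R = m \<and> R \<inter> F = {}} = (card U - card F) choose m"
proof -
  have "{R. R \<subseteq> U \<and> card R = m \<and> R \<inter> F = {}} = {R. R \<subseteq> U - F \<and> card R = m}" by auto
  then show ?thesis using assms by (simp add: n_subsets card_Diff_subset finite_subset)
qed

lemma choose_absorb: "real (Suc m) * real (k choose Suc m) = real (k - m) * real (k choose m)"
  unfolding of_nat_mult[symmetric] binomial_absorption binomial_absorb_comp ..

text \<open>
  The probability that a uniform \<open>m\<close>-subset of an \<open>N\<close>-set avoids \<open>f\<close> given elements is at most
  \<open>(1 - f / N) ^ m\<close>, as if the elements were drawn with replacement.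
\<close>

lemma choose_diff_le:
  assumes "f \<le> N" "0 < N"
  shows "real ((N - f) choose m) \<le> exp (- (real f * real m / real N)) * real (N choose m)"
proof -
  have "real ((N - f) choose m) \<le> (1 - real f / real N) ^ m * real (N choose m)"
  proof (induction m)
    case (Suc m)
    let ?q = "1 - real f / real N"
    have q: "0 \<le> ?q" using assms by simp
    have "real (N - f - m) \<le> ?q * real (N - m)"
    proof (cases "m \<le> N - f")
      case True
      have "(real N - real f - real m) * real N \<le> (real N - real f) * (real N - real m)"
        by (simp add: algebra_simps)
      then show ?thesis using True assms by (simp add: of_nat_diff field_simps)
    qed (use q in simp)
    then have "real (N - f - m) * real ((N - f) choose m)
        \<le> (?q * real (N - m)) * (?q ^ m * real (N choose m))"
      using Suc q by (intro mult_mono) auto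
    also have "(?q * real (N - m)) * (?q ^ m * real (N choose m)) = ?q ^ Suc m * (real (N - m) * real (N choose m))"
      by (simp only: power_Suc mult_ac)
    finally have "real (Suc m) * real ((N - f) choose Suc m)
        \<le> real (Suc m) * (?q ^ Suc m * real (N choose Suc m))"
      unfolding choose_absorb[symmetric] by (simp only: mult_ac)
    then show ?case by (simp only: mult_le_cancel_left_pos of_nat_0_less_iff zero_less_Suc)
  qed simp
  also have "(1 - real f / real N) ^ m \<le> exp (- (real f / real N)) ^ m"
    using assms exp_ge_add_one_self[of "- (real f / real N)"] by (intro power_mono) auto
  also have "\<dots> = exp (- (real f * real m / real N))"
    by (simp add: exp_of_nat_mult[symmetric] mult.commute)
  finally show ?thesis by (simp add: mult_right_mono)
qed

lemma card_avoiding_le: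
  assumes "finite U" "F \<subseteq> U" "F \<noteq> {}"
  shows "real (card {R. R \<subseteq> U \<and> card R = m \<and> R \<inter> F = {}})
    \<le> exp (- (real (card F) * real m / real (card U))) * real (card U choose m)"
proof -
  have "card U > 0" using assms by (auto simp: card_gt_0_iff)
  then show ?thesis using card_avoiding[OF assms(1,2)] choose_diff_le[of "card F" "card U" m] assms card_mono[of U F] by simp
qed

text \<open>
  The counterpart of \<open>choose_diff_le\<close>: while at least \<open>M + k\<close> elements are left, a single draw avoids \<open>k\<close> given
  elements with probability at least \<open>1 / (1 + k / M)\<close>.
\<close>

lemma choose_le_choose_diff:
  assumes M: "0 < M"
  shows "M + real k + real m \<le> real N \<Longrightarrow>
    real (N choose m) \<le> (1 + real k / M) ^ m * real ((N - k) choose m)"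
proof (induction m)
  case (Suc m)
  let ?q = "1 + real k / M"
  have q: "0 \<le> ?q" using M by simp
  have "real (N - m) \<le> ?q * real (N - k - m)"
  proof -
    have "real k * M \<le> real k * (real N - real k - real m)" using Suc.prems by (intro mult_left_mono) auto
    moreover have "real (N - m) = real N - real m" "real (N - k - m) = real N - real k - real m"
      using Suc.prems M by (auto simp: of_nat_diff)
    ultimately show ?thesis using M by (simp add: field_simps)
  qed
  then have "real (N - m) * real (N choose m) \<le> (?q * real (N - k - m)) * (?q ^ m * real ((N - k) choose m))"
    using Suc q by (intro mult_mono) auto
  also have "\<dots> = ?q ^ Suc m * (real (N - k - m) * real ((N - k) choose m))"
    by (simp only: power_Suc mult_ac)
  finally have "real (Suc m) * real (N choose Suc m) \<le> real (Suc m) * (?q ^ Suc m * real ((N - k) choose Suc m))"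
    unfolding choose_absorb[symmetric] by (simp only: mult_ac)
  then show ?case by (rule mult_left_le_imp_le) simp
qed simp

text \<open>
  Avoiding two \<open>k\<close>-sets with one common element is almost as unlikely as if the two events were independent. After
  \<open>m\<close> draws put \<open>x = N - k - m\<close>; then the comparison for the next draw is
  \<open>(x - k + 1) (x + k) \<le> x\<^sup>2 + x\<close>.
\<close>

lemma choose_pair_correlation:
  assumes M: "0 < M" and k: "1 \<le> k"
  shows "M + real k + real m \<le> real N \<Longrightarrow>
    real ((N - (2 * k - 1)) choose m) * real (N choose m) \<le> (1 + 1 / M) ^ m * (real ((N - k) choose m))\<^sup>2"
proof (induction m)
  case (Suc m)
  let ?q = "1 + 1 / M"
  let ?P = "N - (2 * k - 1)"
  define x where "x = real N - real k - real m"
  have x: "M \<le> x" "real (N - k - m) = x" "real (N - m) = x + real k"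
    using Suc.prems M by (auto simp: x_def of_nat_diff)
  have "real (?P - m) * (x + real k) \<le> ?q * x\<^sup>2"
  proof (cases "m + (2 * k - 1) \<le> N")
    case True
    then have "real (?P - m) = x - real k + 1" using k by (simp add: x_def of_nat_diff)
    then have "real (?P - m) * (x + real k) = (x - real k + 1) * (x + real k)" by (simp only:)
    also have "\<dots> = x\<^sup>2 + x + (real k - (real k)\<^sup>2)"
      by (simp add: power2_eq_square algebra_simps)
    also have "\<dots> \<le> x\<^sup>2 + x" using k by (simp add: power2_eq_square)
    also have "\<dots> \<le> ?q * x\<^sup>2"
      using M x(1) mult_right_mono[of M x x] by (simp add: field_simps power2_eq_square)
    finally show ?thesis .
  qed (use M in simp)
  then have "real (?P - m) * (x + real k) * (real (?P choose m) * real (N choose m))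
      \<le> ?q * x\<^sup>2 * (?q ^ m * (real ((N - k) choose m))\<^sup>2)"
    by (rule mult_mono) (use Suc M in auto)
  then have "(real (?P - m) * real (?P choose m)) * (real (N - m) * real (N choose m))
      \<le> ?q ^ Suc m * (real (N - k - m) * real ((N - k) choose m))\<^sup>2"
    unfolding x by (simp only: power_Suc power_mult_distrib mult_ac)
  then have "(real (Suc m))\<^sup>2 * (real (?P choose Suc m) * real (N choose Suc m))
      \<le> (real (Suc m))\<^sup>2 * (?q ^ Suc m * (real ((N - k) choose Suc m))\<^sup>2)"
    unfolding choose_absorb[symmetric] by (simp only: power2_eq_square mult_ac)
  then show ?case by (rule mult_left_le_imp_le) simp
qed simp

lemma choose_le_exp_power:
  assumes "0 < s"
  shows "real (n choose s) \<le> (exp 1 * real n / real s) ^ s"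
proof -
  have "real s ^ s / fact s \<le> exp (real s)"
    using sum_le_suminf[OF sums_summable[OF exp_converges[of "real s"]], of "{s}"]
      sums_unique[OF exp_converges[of "real s"]] by (simp add: divide_inverse mult.commute)
  then have f: "real s ^ s \<le> exp 1 ^ s * fact s"
    by (simp add: exp_of_nat_mult[symmetric] field_simps)
  have b: "real (n choose s) * fact s \<le> real n ^ s"
    using binomial_fact_pow[of n s] by (metis of_nat_fact of_nat_le_iff of_nat_mult of_nat_power)
  have "real s ^ s * real (n choose s) \<le> (exp 1 ^ s * fact s) * real (n choose s)"
    using f by (rule mult_right_mono) simp
  also have "\<dots> \<le> exp 1 ^ s * real n ^ s"
    using mult_left_mono[OF b, of "exp 1 ^ s"] by (simp add: mult_ac)
  finally show ?thesis using assms by (simp add: power_divide power_mult_distrib field_simps)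
qed

text \<open>
  Chebyshev's inequality for the number of indices \<open>v\<close> with \<open>Y R v\<close>, where \<open>R\<close> is uniform in \<open>S\<close>: each event has
  probability \<open>q\<close>, and any two of them hold together with probability at most \<open>p\<close>.
\<close>

lemma chebyshev_count:
  fixes Y :: "'r \<Rightarrow> 'v \<Rightarrow> bool" and q p t :: real
  assumes fin: "finite S" "finite I"
    and one: "\<And>v. v \<in> I \<Longrightarrow> real (card {R \<in> S. Y R v}) = q * real (card S)"
    and two: "\<And>u v. u \<in> I \<Longrightarrow> v \<in> I \<Longrightarrow> u \<noteq> v \<Longrightarrow> real (card {R \<in> S. Y R u \<and> Y R v}) \<le> p * real (card S)"
    and q: "q \<le> 1" and p: "0 \<le> p" and t: "t \<le> real (card I) * q"
  shows "real (card {R \<in> S. real (card {v \<in> I. Y R v}) \<le> t}) * (real (card I) * q - t)\<^sup>2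
    \<le> (real (card I) + (real (card I))\<^sup>2 * (p - q\<^sup>2)) * real (card S)"
proof -
  define b where "b = real (card I)"
  define M where "M = real (card S)"
  define X where "X R = real (card {v \<in> I. Y R v})" for R
  have X: "X R = (\<Sum>v\<in>I. of_bool (Y R v))" for R
    using fin(2) by (simp add: X_def Int_def)
  have sum1: "(\<Sum>R\<in>S. X R) = b * q * M"
  proof -
    have "(\<Sum>R\<in>S. X R) = (\<Sum>v\<in>I. \<Sum>R\<in>S. of_bool (Y R v))" unfolding X by (rule sum.swap)
    also have "\<dots> = (\<Sum>v\<in>I. q * M)"
      using one fin(1) by (intro sum.cong) (auto simp: M_def Int_def)
    finally show ?thesis by (simp add: b_def)
  qed
  have sum2: "(\<Sum>R\<in>S. (X R)\<^sup>2) \<le> b * M + b\<^sup>2 * p * M"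
  proof -
    have "(\<Sum>R\<in>S. (X R)\<^sup>2) = (\<Sum>R\<in>S. \<Sum>u\<in>I. \<Sum>v\<in>I. of_bool (Y R u \<and> Y R v))"
      unfolding X power2_eq_square sum_product by (simp add: of_bool_conj)
    also have "\<dots> = (\<Sum>u\<in>I. \<Sum>R\<in>S. \<Sum>v\<in>I. of_bool (Y R u \<and> Y R v))" by (rule sum.swap)
    also have "\<dots> = (\<Sum>u\<in>I. \<Sum>v\<in>I. \<Sum>R\<in>S. of_bool (Y R u \<and> Y R v))"
      by (rule sum.cong[OF HOL.refl], rule sum.swap)
    also have "\<dots> = (\<Sum>u\<in>I. \<Sum>v\<in>I. real (card {R \<in> S. Y R u \<and> Y R v}))"
      using fin(1) by (simp add: Int_def)
    also have "\<dots> \<le> (\<Sum>u\<in>I. \<Sum>v\<in>I. (if u = v then M else 0) + p * M)"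
    proof (intro sum_mono)
      fix u v assume uv: "u \<in> I" "v \<in> I"
      show "real (card {R \<in> S. Y R u \<and> Y R v}) \<le> (if u = v then M else 0) + p * M"
      proof (cases "u = v")
        case True
        have "card {R \<in> S. Y R u \<and> Y R v} \<le> card S" using fin(1) by (intro card_mono) auto
        then show ?thesis using True p by (simp add: M_def add_increasing2)
      qed (use two uv in \<open>simp add: M_def\<close>)
    qed
    also have "\<dots> = b * M + b\<^sup>2 * p * M"
      using fin(2) by (simp add: sum.distrib b_def power2_eq_square algebra_simps)
    finally show ?thesis .
  qed
  have "real (card {R \<in> S. X R \<le> t}) * (b * q - t)\<^sup>2 = (\<Sum>R | R \<in> S \<and> X R \<le> t. (b * q - t)\<^sup>2)" by simp
  also have "\<dots> \<le> (\<Sum>R | R \<in> S \<and> X R \<le> t. (b * q - X R)\<^sup>2)"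
    using t by (intro sum_mono power_mono) (auto simp: b_def)
  also have "\<dots> \<le> (\<Sum>R\<in>S. (b * q - X R)\<^sup>2)"
    using fin(1) by (intro sum_mono2) auto
  also have "\<dots> = (b * q)\<^sup>2 * M - 2 * (b * q) * (\<Sum>R\<in>S. X R) + (\<Sum>R\<in>S. (X R)\<^sup>2)"
    by (simp add: power2_diff sum.distrib sum_subtractf M_def flip: sum_distrib_left)
  also have "\<dots> \<le> (b + b\<^sup>2 * (p - q\<^sup>2)) * M"
    using sum2 unfolding sum1 by (simp add: power2_eq_square algebra_simps)
  finally show ?thesis by (simp add: b_def M_def X_def)
qed

section \<open>Random edges in an expanding graph\<close>

text \<open>
  Let \<open>L\<close> bound the number of vertices missed by a longest path. As long as the graph is not Hamiltonian, the next
  edge is a booster with probability at least \<open>1/16\<close>, and a booster lowers \<open>L\<close> or produces a Hamiltonian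
  cycle. Hence one step multiplies the expectation of \<open>(11/10) ^ L\<close> by at most
  \<open>15/16 + 1/16 * 10/11 = 175/176\<close>. Drawing the edges one at a time turns this into an induction on \<open>m\<close>.
\<close>

lemma few_failures:
  assumes n: "10 \<le> n"
  shows "E \<subseteq> nsets {1..n} 2 \<Longrightarrow> expands n E \<Longrightarrow> is_path n E P \<Longrightarrow> n \<le> length P + L \<Longrightarrow>
    real (card {R. R \<subseteq> non_edges n E \<and> card R = m \<and> \<not> hamiltonian n (E \<union> R)})
      \<le> (11/10) ^ Suc L * (175/176) ^ m * real (card (non_edges n E) choose m)"
proof (induction m arbitrary: E L P)
  case 0
  have "{R. R \<subseteq> non_edges n E \<and> card R = 0 \<and> \<not> hamiltonian n (E \<union> R)} \<subseteq> {{}}"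
    using finite_subset[OF _ finite_non_edges] by auto
  from card_mono[OF _ this]
  have "real (card {R. R \<subseteq> non_edges n E \<and> card R = 0 \<and> \<not> hamiltonian n (E \<union> R)}) \<le> 1" by simp
  also have "1 \<le> (11/10::real) ^ Suc L" by (rule one_le_power) simp
  finally show ?case by simp
next
  case (Suc m)
  define U where "U = non_edges n E"
  define N where "N = card U"
  define bad where "bad e = card {B. B \<subseteq> U - {e} \<and> card B = m \<and> \<not> hamiltonian n (insert e E \<union> B)}" for e
  have finU: "finite U" by (simp add: U_def finite_non_edges)
  show ?case
  proof (cases "hamiltonian n E")
    case True
    then have none: "{R. R \<subseteq> non_edges n E \<and> card R = Suc m \<and> \<not> hamiltonian n (E \<union> R)} = {}"
      using hamiltonian_mono[of n E] by blast
    show ?thesis unfolding none by simp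
  next
    case nh: False
    obtain P' where P': "is_path n E P'" and longest: "\<And>Q. is_path n E Q \<Longrightarrow> length Q \<le> length P'"
      using exists_longest_path[of n E] n by auto
    define l where "l = length P'"
    define G where "G = {e \<in> U. improves n (insert e E) l}"
    have lL: "n \<le> l + L" using longest[OF Suc.prems(3)] Suc.prems(4) by (simp add: l_def)
    have ln: "l \<le> n" using is_path_length[OF P'] by (simp add: l_def)
    have step: "insert e E \<subseteq> nsets {1..n} 2" "expands n (insert e E)" "non_edges n (insert e E) = U - {e}"
      if "e \<in> U" for e
    proof -
      show 1: "insert e E \<subseteq> nsets {1..n} 2" using that Suc.prems(1) by (auto simp: U_def non_edges_def)
      show "expands n (insert e E)" using expands_mono[OF Suc.prems(2) _ 1] by blast
      show "non_edges n (insert e E) = U - {e}" by (auto simp: U_def non_edges_def)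
    qed
    \<comment> \<open>\<open>c\<close> is what the induction hypothesis gives for an arbitrary first edge; for a booster it can be
        applied with \<open>L - 1\<close>, which gains the factor \<open>10/11\<close>.\<close>
    define c where "c = (11/10::real) ^ Suc L * (175/176) ^ m * real ((N - 1) choose m)"
    have c0: "0 \<le> c" by (simp add: c_def)
    have any: "real (bad e) \<le> c" if "e \<in> U" for e
      using Suc.IH[OF step(1,2)[OF that] is_path_mono[OF Suc.prems(3)] Suc.prems(4)] that finU
      unfolding bad_def c_def N_def step(3)[OF that] by (simp add: subset_insertI)
    have good: "real (bad e) \<le> 10/11 * c" if e: "e \<in> G" for e
    proof (cases "hamiltonian n (insert e E)")
      case True
      then have none: "{B. B \<subseteq> U - {e} \<and> card B = m \<and> \<not> hamiltonian n (insert e E \<union> B)} = {}"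
        using hamiltonian_mono[of n "insert e E"] by blast
      show ?thesis unfolding bad_def none using c0 by simp
    next
      case False
      then obtain Q where Q: "is_path n (insert e E) Q" "length Q = Suc l"
        using e by (auto simp: G_def improves_def)
      have eU: "e \<in> U" using e by (simp add: G_def)
      have "Suc l \<le> n" using is_path_length[OF Q(1)] Q(2) by simp
      then obtain L' where L': "L = Suc L'" using lL by (cases L) auto
      have "n \<le> length Q + L'" using lL L' Q(2) by simp
      from Suc.IH[OF step(1,2)[OF eU] Q(1) this]
      show ?thesis unfolding bad_def c_def N_def step(3)[OF eU] L' using finU eU by (simp add: mult_ac)
    qed
    have Gcard: "16 * card G \<ge> N"
    proof -
      have "n\<^sup>2 \<le> 32 * card G" unfolding G_def U_def l_def
        by (rule many_boosters[OF n Suc.prems(1,2) nh P' longest])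
      then show ?thesis using card_non_edges_le[of n E] by (simp add: N_def U_def)
    qed
    have GU: "G \<subseteq> U" by (auto simp: G_def)
    have "real (Suc m * card {R. R \<subseteq> U \<and> card R = Suc m \<and> \<not> hamiltonian n (E \<union> R)})
        = (\<Sum>e\<in>U. real (bad e))"
      unfolding one_step_count[OF finU] bad_def by simp
    also have "\<dots> = (\<Sum>e\<in>G. real (bad e)) + (\<Sum>e\<in>U - G. real (bad e))"
      using sum.subset_diff[OF GU finU, of "\<lambda>e. real (bad e)"] by simp
    also have "\<dots> \<le> (\<Sum>e\<in>G. 10/11 * c) + (\<Sum>e\<in>U - G. c)"
      by (intro add_mono sum_mono good any) auto
    also have "\<dots> = (real N - real (card G) / 11) * c"
    proof -
      have "card (U - G) = N - card G" "card G \<le> N"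
        using GU finU by (auto simp: N_def card_Diff_subset finite_subset card_mono)
      then show ?thesis by (simp add: of_nat_diff algebra_simps)
    qed
    also have "\<dots> \<le> (175/176 * real N) * c"
      using Gcard c0 by (intro mult_right_mono) auto
    also have "(175/176 * real N) * c
        = (11/10) ^ Suc L * (175/176) ^ Suc m * (real N * real ((N - 1) choose m))"
      unfolding c_def by (simp only: power_Suc mult_ac)
    also have "real N * real ((N - 1) choose m) = real (Suc m) * real (N choose Suc m)"
      by (simp only: binomial_absorption flip: of_nat_mult)
    finally have "real (Suc m) * real (card {R. R \<subseteq> U \<and> card R = Suc m \<and> \<not> hamiltonian n (E \<union> R)})
        \<le> real (Suc m) * ((11/10) ^ Suc L * (175/176) ^ Suc m * real (N choose Suc m))"
      by (simp only: of_nat_mult mult_ac)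
    then show ?thesis
      unfolding U_def N_def by (rule mult_left_le_imp_le) simp
  qed
qed

section \<open>Dense graphs expand after adding random edges\<close>

lemma dense_graph_subset: "H \<in> dense_graphs n d \<Longrightarrow> H \<subseteq> nsets {1..n} 2"
  by (simp add: dense_graphs_def)

lemma degree_eq_card_neighbours:
  assumes E: "E \<subseteq> nsets {1..n} 2"
  shows "degree E v = card {w. {v, w} \<in> E}"
proof -
  have "{e \<in> E. v \<in> e} = (\<lambda>w. {v, w}) ` {w. {v, w} \<in> E}"
  proof (intro equalityI subsetI)
    fix e assume e: "e \<in> {e \<in> E. v \<in> e}"
    then have "card e = 2" using E by (auto simp: nsets_def)
    then obtain a b where "e = {a, b}" by (auto simp: card_2_iff)
    then have "e = {v, if v = a then b else a}" using e by auto
    then show "e \<in> (\<lambda>w. {v, w}) ` {w. {v, w} \<in> E}" using e by auto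
  qed auto
  moreover have "inj_on (\<lambda>w. {v, w}) {w. {v, w} \<in> E}"
    by (auto simp: inj_on_def doubleton_eq_iff)
  ultimately show ?thesis by (simp add: degree_def card_image)
qed

text \<open>
  A vertex of \<open>S\<close> has all its neighbours in \<open>S\<close> or in the outer neighbourhood of \<open>S\<close>, which together have fewer
  than \<open>3 |S|\<close> elements.
\<close>

lemma min_degree_expansion:
  assumes H: "H \<in> dense_graphs n d" and E: "H \<subseteq> E" "E \<subseteq> nsets {1..n} 2"
    and S: "S \<subseteq> {1..n}" "S \<noteq> {}" and small: "card (nbhd E S) < 2 * card S"
  shows "d * real n < 3 * real (card S)"
proof -
  obtain v where v: "v \<in> S" using S by blast
  have finS: "finite S" using S(1) finite_subset by blast
  have Hn: "H \<subseteq> nsets {1..n} 2" by (rule dense_graph_subset[OF H])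
  have "{w. {v, w} \<in> H} \<subseteq> S \<union> nbhd E S" using v E by (auto simp: nbhd_def)
  then have "degree H v \<le> card S + card (nbhd E S)"
    unfolding degree_eq_card_neighbours[OF Hn]
    using finS finite_nbhd[OF E(2)] by (intro order.trans[OF card_mono card_Un_le]) auto
  moreover have "min_degree n H \<le> degree H v"
    using v S(1) by (auto simp: min_degree_def)
  moreover have "d * real n \<le> real (min_degree n H)" using H by (simp add: dense_graphs_def)
  ultimately show ?thesis using small by linarith
qed

definition cross :: "nat set \<Rightarrow> nat set \<Rightarrow> edges" where
  "cross S W = (\<lambda>(u, w). {u, w}) ` (S \<times> W)"

lemma card_cross:
  assumes "S \<inter> W = {}"
  shows "card (cross S W) = card S * card W"
proof -
  have "inj_on (\<lambda>(u, w). {u, w}) (S \<times> W)"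
    using assms by (auto simp: inj_on_def doubleton_eq_iff)
  then show ?thesis by (simp add: cross_def card_image card_cartesian_product)
qed

text \<open>
  The candidates for a failure of expansion: \<open>S\<close> violates it only if its neighbours fit into a set \<open>T\<close> of
  twice its size, so that neither \<open>H\<close> nor the random edges join \<open>S\<close> to the rest.
\<close>

definition separated_pairs :: "nat \<Rightarrow> edges \<Rightarrow> nat \<Rightarrow> (nat set \<times> nat set) set" where
  "separated_pairs n H s = {(S, T). S \<subseteq> {1..n} \<and> card S = s \<and> T \<subseteq> {1..n} - S \<and> card T = 2 * s \<and>
     cross S ({1..n} - S - T) \<subseteq> non_edges n H}"

lemma card_separated_pairs:
  "finite (separated_pairs n H s)"
  "card (separated_pairs n H s) \<le> (n choose s) * (n choose (2 * s))"
proof -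
  let ?P = "{S. S \<subseteq> {1..n} \<and> card S = s} \<times> {T. T \<subseteq> {1..n} \<and> card T = 2 * s}"
  have sub: "separated_pairs n H s \<subseteq> ?P" by (auto simp: separated_pairs_def)
  have fin: "finite ?P" using finite_subsets_of_size[of "{1..n}" _ "\<lambda>_. True"] by auto
  show "finite (separated_pairs n H s)" by (rule finite_subset[OF sub fin])
  show "card (separated_pairs n H s) \<le> (n choose s) * (n choose (2 * s))"
    using card_mono[OF fin sub] by (simp add: card_cartesian_product n_subsets)
qed

lemma separated_pair_if_not_expands:
  assumes H: "H \<in> dense_graphs n d" and R: "R \<subseteq> non_edges n H" and bad: "\<not> expands n (H \<union> R)"
  shows "\<exists>s S T. 4 * s \<le> n \<and> d * real n < 3 * real s \<and> (S, T) \<in> separated_pairs n H s \<and>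
           R \<inter> cross S ({1..n} - S - T) = {}"
proof -
  have G: "H \<union> R \<subseteq> nsets {1..n} 2" using dense_graph_subset[OF H] R by (auto simp: non_edges_def)
  from bad obtain S where S: "S \<subseteq> {1..n}" "S \<noteq> {}" "4 * card S \<le> n"
    and small: "card (nbhd (H \<union> R) S) < 2 * card S" by (auto simp: expands_def not_le)
  have "card ({1..n} - S) = n - card S" using S(1) by (simp add: card_Diff_subset finite_subset)
  then have "\<exists>T. nbhd (H \<union> R) S \<subseteq> T \<and> T \<subseteq> {1..n} - S \<and> card T = 2 * card S"
    using small S(3) nbhd_subset[OF G, of S]
    by (intro exists_subset_between) (auto simp: nbhd_def)
  then obtain T where T: "nbhd (H \<union> R) S \<subseteq> T" "T \<subseteq> {1..n} - S" "card T = 2 * card S" by blast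
  have none: "cross S ({1..n} - S - T) \<inter> (H \<union> R) = {}"
    using T(1) by (auto simp: cross_def nbhd_def)
  moreover have "cross S ({1..n} - S - T) \<subseteq> nsets {1..n} 2"
    using S(1) by (auto simp: cross_def nsets_2_eq)
  ultimately have "(S, T) \<in> separated_pairs n H (card S)" "R \<inter> cross S ({1..n} - S - T) = {}"
    using S T by (auto simp: separated_pairs_def non_edges_def)
  moreover have "d * real n < 3 * real (card S)"
    by (rule min_degree_expansion[OF H _ G S(1,2) small]) auto
  ultimately show ?thesis using S(3) by blast
qed

text \<open>
  There are \<open>s (n - 3 s)\<close>, hence at least \<open>s n / 4\<close>, pairs to avoid among at most \<open>n\<^sup>2 / 2\<close> non-edges.
\<close>

lemma card_avoiding_separated_pair:
  assumes p: "(S, T) \<in> separated_pairs n H s" and s: "0 < s" "4 * s \<le> n"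
  shows "real (card {R. R \<subseteq> non_edges n H \<and> card R = m \<and> R \<inter> cross S ({1..n} - S - T) = {}})
    \<le> exp (- (real s * real m / (2 * real n))) * real (card (non_edges n H) choose m)"
proof -
  define F where "F = cross S ({1..n} - S - T)"
  define N where "N = card (non_edges n H)"
  have FU: "F \<subseteq> non_edges n H" using p by (auto simp: F_def separated_pairs_def)
  have cards: "card S = s" "card T = 2 * s" "S \<subseteq> {1..n}" "T \<subseteq> {1..n} - S"
    using p by (auto simp: separated_pairs_def)
  have "card ({1..n} - S - T) = n - 3 * s"
    using cards finite_subset[OF cards(3)] finite_subset[OF cards(4)]
    by (simp add: card_Diff_subset)
  then have cF: "card F = s * (n - 3 * s)"
    unfolding F_def by (subst card_cross) (auto simp: cards)
  then have "F \<noteq> {}" using s by auto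
  have N0: "0 < N" using FU \<open>F \<noteq> {}\<close> finite_non_edges[of n H] by (auto simp: N_def card_gt_0_iff)
  have "real N \<le> (real n)\<^sup>2 / 2" using card_non_edges_le[of n H] by (simp add: N_def flip: of_nat_power)
  moreover have "real s * (real n / 4) \<le> real (card F)"
    unfolding cF using s by (simp add: of_nat_diff)
  ultimately have "(real s * (real n / 4)) * real m / ((real n)\<^sup>2 / 2) \<le> real (card F) * real m / real N"
    using N0 by (intro frac_le mult_right_mono) auto
  moreover have "(real s * (real n / 4)) * real m / ((real n)\<^sup>2 / 2) = real s * real m / (2 * real n)"
    using s by (simp add: power2_eq_square)
  ultimately have "exp (- (real (card F) * real m / real N)) \<le> exp (- (real s * real m / (2 * real n)))"
    by simp
  then show ?thesis
    using card_avoiding_le[OF finite_non_edges FU \<open>F \<noteq> {}\<close>, of m]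
    unfolding F_def[symmetric] N_def[symmetric]
    by (meson mult_right_mono of_nat_0_le_iff order.trans)
qed

text \<open>
  Since \<open>n / s < 3 / d\<close>, the number of pairs is at most \<open>(e n / s) ^ s * (e n / (2 s)) ^ (2 s)\<close>, which is at
  most \<open>(27/4 * exp (3 + 3 \<theta>)) ^ s\<close> for \<open>\<theta> = ln (1 / d)\<close>. The exponential factor is at most
  \<open>exp (- (3 \<theta> + 11/2)) ^ s\<close>, so \<open>\<theta>\<close> cancels and the product is at most
  \<open>exp (- s / 2)\<close>.
\<close>

lemma few_separated_pairs:
  assumes d: "0 < d" and s: "d * real n < 3 * real s" and n: "0 < n"
    and m: "(6 * ln (inverse d) + 11) * real n \<le> real m"
  shows "real (card (separated_pairs n H s)) * exp (- (real s * real m / (2 * real n)))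
     \<le> exp (- (d * real n / 6))"
proof -
  have s0: "0 < s" using s d n by (metis gr0I mult_pos_pos mult_zero_right not_less_iff_gr_or_eq of_nat_0 of_nat_0_less_iff)
  have ns: "real n / real s \<le> 3 / d" using s s0 d by (simp add: field_simps)
  have "real (n choose s) \<le> (exp 1 * (3 / d)) ^ s"
  proof -
    have "exp 1 * (real n / real s) \<le> exp 1 * (3 / d)" using ns by (rule mult_left_mono) simp
    from power_mono[OF this, of s] choose_le_exp_power[OF s0, of n] show ?thesis by simp
  qed
  moreover have "real (n choose (2 * s)) \<le> ((exp 1 * (3 / (2 * d)))\<^sup>2) ^ s"
  proof -
    have "exp 1 * (real n / real (2 * s)) \<le> exp 1 * (3 / (2 * d))"
      using mult_left_mono[OF ns, of "exp 1 / 2"] by simp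
    from power_mono[OF this, of "2 * s"] choose_le_exp_power[of "2 * s" n] s0
    have "real (n choose (2 * s)) \<le> (exp 1 * (3 / (2 * d))) ^ (2 * s)" by simp
    then show ?thesis unfolding power_mult .
  qed
  ultimately have "real (n choose s) * real (n choose (2 * s))
      \<le> (exp 1 * (3 / d)) ^ s * ((exp 1 * (3 / (2 * d)))\<^sup>2) ^ s"
    using d by (intro mult_mono) auto
  also have "\<dots> = (27 / 4 * (exp 1 * inverse d) ^ 3) ^ s"
    unfolding power_mult_distrib[symmetric]
    by (simp add: power2_eq_square power3_eq_cube field_simps)
  also have "(exp 1 * inverse d) ^ 3 = exp (3 + 3 * ln (inverse d))"
  proof -
    have "exp 1 * inverse d = exp (1 + ln (inverse d))" using d by (simp add: exp_add)
    then show ?thesis by (simp add: exp_of_nat_mult[symmetric] algebra_simps)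
  qed
  finally have "real ((n choose s) * (n choose (2 * s))) \<le> (27 / 4 * exp (3 + 3 * ln (inverse d))) ^ s"
    by (simp only: of_nat_mult)
  moreover have "real (card (separated_pairs n H s)) \<le> real ((n choose s) * (n choose (2 * s)))"
    using card_separated_pairs(2)[of n H s] by (simp only: of_nat_le_iff)
  ultimately have count: "real (card (separated_pairs n H s)) \<le> (27 / 4 * exp (3 + 3 * ln (inverse d))) ^ s"
    by (rule order.trans[rotated])
  have "real s * ((6 * ln (inverse d) + 11) / 2) \<le> real s * (real m / (2 * real n))"
    using m n by (intro mult_left_mono) (auto simp: field_simps)
  then have "exp (- (real s * real m / (2 * real n))) \<le> exp (- ((6 * ln (inverse d) + 11) / 2)) ^ s"
    by (simp add: exp_of_nat_mult[symmetric])
  then have "real (card (separated_pairs n H s)) * exp (- (real s * real m / (2 * real n)))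
     \<le> (27 / 4 * exp (3 + 3 * ln (inverse d))) ^ s * exp (- ((6 * ln (inverse d) + 11) / 2)) ^ s"
    using count by (intro mult_mono) auto
  also have "\<dots> = (27 / 4 * exp (- (5 / 2))) ^ s"
  proof -
    have "3 + 3 * ln (inverse d) + - ((6 * ln (inverse d) + 11) / 2) = - (5 / 2)"
      by (simp add: field_simps)
    then show ?thesis
      unfolding power_mult_distrib[symmetric] mult.assoc exp_add[symmetric] by (simp only:)
  qed
  \<comment> \<open>It remains that \<open>27 / 4 \<le> exp 2\<close>.\<close>
  also have "\<dots> \<le> exp (- (1 / 2)) ^ s"
  proof (intro power_mono)
    have "(13 / 8 :: real) \<le> exp (1 / 2)"
      using exp_lower_Taylor_quadratic[of "1/2"] by (simp add: power2_eq_square)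
    then have "(13 / 8) ^ 4 \<le> exp (1 / 2 :: real) ^ 4" by (rule power_mono) simp
    also have "\<dots> = exp 2" by (simp flip: exp_of_nat_mult)
    finally have "27 / 4 \<le> exp (2 :: real)" by (simp add: power4_eq_xxxx)
    from mult_right_mono[OF this, of "exp (- (5 / 2))"]
    show "27 / 4 * exp (- (5 / 2)) \<le> exp (- (1 / 2) :: real)" by (simp add: exp_add[symmetric])
  qed auto
  also have "\<dots> \<le> exp (- (d * real n / 6))"
    using s by (simp add: exp_of_nat_mult[symmetric])
  finally show ?thesis .
qed

text \<open>
  The union bound over the sizes \<open>s\<close> and the separated pairs of each size.
\<close>

lemma expansion_fails_rarely:
  assumes d: "0 < d" and H: "H \<in> dense_graphs n d" and n: "0 < n"
    and m: "(6 * ln (inverse d) + 11) * real n \<le> real m"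
  shows "real (card {R. R \<subseteq> non_edges n H \<and> card R = m \<and> \<not> expands n (H \<union> R)})
    \<le> real n * exp (- (d * real n / 6)) * real (card (non_edges n H) choose m)"
proof -
  define U where "U = non_edges n H"
  define I where "I = {s. 4 * s \<le> n \<and> d * real n < 3 * real s}"
  define A where "A = (\<lambda>(S, T). {R. R \<subseteq> U \<and> card R = m \<and> R \<inter> cross S ({1..n} - S - T) = {}})"
  define c where "c = exp (- (d * real n / 6))"
  have sub: "I \<subseteq> {1..n}"
  proof
    fix s assume s: "s \<in> I"
    moreover have "0 < d * real n" using d n by simp
    ultimately show "s \<in> {1..n}" by (cases s) (auto simp: I_def)
  qed
  then have finI: "finite I" by (rule finite_subset) simp
  have finA: "finite (A p)" for p
    using finite_subsets_of_size[OF finite_non_edges] by (auto simp: A_def U_def split: prod.split)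
  have "{R. R \<subseteq> U \<and> card R = m \<and> \<not> expands n (H \<union> R)} \<subseteq> (\<Union>s\<in>I. \<Union>p\<in>separated_pairs n H s. A p)"
  proof
    fix R assume "R \<in> {R. R \<subseteq> U \<and> card R = m \<and> \<not> expands n (H \<union> R)}"
    then have R: "R \<subseteq> U" "card R = m" "\<not> expands n (H \<union> R)" by auto
    then obtain s S T where "s \<in> I" "(S, T) \<in> separated_pairs n H s" "R \<inter> cross S ({1..n} - S - T) = {}"
      using separated_pair_if_not_expands[OF H, of R] by (auto simp: U_def I_def)
    moreover from this(3) R have "R \<in> A (S, T)" by (simp add: A_def)
    ultimately show "R \<in> (\<Union>s\<in>I. \<Union>p\<in>separated_pairs n H s. A p)" by blast
  qed
  then have "card {R. R \<subseteq> U \<and> card R = m \<and> \<not> expands n (H \<union> R)}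
      \<le> card (\<Union>s\<in>I. \<Union>p\<in>separated_pairs n H s. A p)"
    using finI finA card_separated_pairs(1) by (intro card_mono) auto
  also have "\<dots> \<le> (\<Sum>s\<in>I. card (\<Union>p\<in>separated_pairs n H s. A p))"
    by (rule card_UN_le[OF finI])
  also have "\<dots> \<le> (\<Sum>s\<in>I. \<Sum>p\<in>separated_pairs n H s. card (A p))"
    by (intro sum_mono card_UN_le card_separated_pairs(1))
  finally have "real (card {R. R \<subseteq> U \<and> card R = m \<and> \<not> expands n (H \<union> R)})
      \<le> (\<Sum>s\<in>I. \<Sum>p\<in>separated_pairs n H s. real (card (A p)))"
    by (simp flip: of_nat_sum)
  also have "\<dots> \<le> (\<Sum>s\<in>I. c * real (card U choose m))"
  proof (intro sum_mono)
    fix s assume s: "s \<in> I"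
    then have s0: "0 < s" "4 * s \<le> n" "d * real n < 3 * real s" using sub by (auto simp: I_def)
    have "(\<Sum>p\<in>separated_pairs n H s. real (card (A p)))
        \<le> (\<Sum>p\<in>separated_pairs n H s. exp (- (real s * real m / (2 * real n))) * real (card U choose m))"
    proof (intro sum_mono)
      fix p assume "p \<in> separated_pairs n H s"
      then show "real (card (A p)) \<le> exp (- (real s * real m / (2 * real n))) * real (card U choose m)"
        using card_avoiding_separated_pair[of _ _ n H s m] s0 by (cases p) (simp add: A_def U_def)
    qed
    also have "\<dots> = (real (card (separated_pairs n H s)) * exp (- (real s * real m / (2 * real n)))) * real (card U choose m)"
      by simp
    also have "\<dots> \<le> c * real (card U choose m)"
      unfolding c_def by (intro mult_right_mono few_separated_pairs[OF d s0(3) n m]) simp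
    finally show "(\<Sum>p\<in>separated_pairs n H s. real (card (A p))) \<le> c * real (card U choose m)" .
  qed
  also have "\<dots> = real (card I) * (c * real (card U choose m))" by simp
  also have "\<dots> \<le> real n * (c * real (card U choose m))"
    using card_mono[OF _ sub] by (intro mult_right_mono) (auto simp: c_def)
  finally show ?thesis by (simp add: U_def c_def)
qed

section \<open>Hamiltonicity with high probability\<close>

text \<open>
  The first \<open>(6 \<theta> + 11) n\<close> edges, for \<open>\<theta> = ln (1 / d)\<close>, make the graph expand and the remaining
  \<open>l\<close> serve as boosters. The second term of the bound
  is the potential \<open>(11/10) ^ (n + 1) * (175/176) ^ l\<close> with \<open>l \<ge> 18 n - 1\<close>; it vanishes because \<open>18/176 > 1/10\<close>.
\<close>

lemma failures_after_sprinkling: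
  assumes d: "0 < d" "d \<le> 1/2" and H: "H \<in> dense_graphs n d" and n: "10 \<le> n"
    and m: "(30 * ln (inverse d) + 13) * real n \<le> real m" "m \<le> card (non_edges n H)"
  shows "real (card {R. R \<subseteq> non_edges n H \<and> card R = m \<and> \<not> hamiltonian n (H \<union> R)})
    \<le> (real n * exp (- (d * real n / 6)) + exp ((real n + 1) / 10 - (18 * real n - 1) / 176))
       * real (card (non_edges n H) choose m)"
proof -
  define \<theta> where "\<theta> = ln (inverse d)"
  define U where "U = non_edges n H"
  define N where "N = card U"
  define k where "k = nat \<lceil>(6 * \<theta> + 11) * real n\<rceil>"
  define l where "l = m - k"
  define \<epsilon> where "\<epsilon> = real n * exp (- (d * real n / 6))"
  define \<rho> where "\<rho> = exp ((real n + 1) / 10 - (18 * real n - 1) / 176)"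
  have "2 / 3 \<le> \<theta>"
  proof -
    have "ln 2 \<le> ln (inverse d)" using d by (subst ln_le_cancel_iff) (auto simp: field_simps)
    then show ?thesis using ln2_ge_two_thirds by (simp add: \<theta>_def)
  qed
  from mult_right_mono[OF this, of "real n"]
  have t: "16 * real n \<le> 24 * (\<theta> * real n)" "0 \<le> \<theta> * real n" by auto
  have k: "(6 * \<theta> + 11) * real n \<le> real k" "real k \<le> (6 * \<theta> + 11) * real n + 1"
    using t by (auto simp: k_def algebra_simps intro: of_nat_ceiling) linarith
  have m': "(30 * \<theta> + 13) * real n \<le> real m" using m(1) by (simp add: \<theta>_def)
  have "real k + (18 * real n - 1) \<le> real m"
    using k(2) m' t by (simp add: algebra_simps)
  \<comment> \<open>The second round has at least \<open>(24 \<theta> + 2) n - 1\<close> edges, and \<open>\<theta> \<ge> 2/3\<close>.\<close>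
  then have km: "k \<le> m" and l: "18 * real n - 1 \<le> real l" using n by (auto simp: l_def of_nat_diff)
  have finU: "finite U" by (simp add: U_def finite_non_edges)
  define SA where "SA = {A. A \<subseteq> U \<and> card A = k}"
  define bad where "bad A = card {B. B \<subseteq> U - A \<and> card B = l \<and> \<not> hamiltonian n (H \<union> (A \<union> B))}" for A
  have finSA: "finite SA" using finU by (simp add: SA_def)
  have cSA: "card SA = N choose k" using finU by (simp add: SA_def N_def n_subsets)
  have cUA: "card (U - A) = N - k" if "A \<in> SA" for A
    using that finU by (auto simp: SA_def N_def card_Diff_subset finite_subset)
  define M where "M = real ((N - k) choose l)"
  have any: "real (bad A) \<le> M" if A: "A \<in> SA" for A
  proof -
    have "bad A \<le> card {B. B \<subseteq> U - A \<and> card B = l}"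
      unfolding bad_def using finU by (intro card_mono) auto
    then show ?thesis using finU cUA[OF A] by (simp add: n_subsets M_def)
  qed
  have good: "real (bad A) \<le> \<rho> * M" if A: "A \<in> SA" and ex: "expands n (H \<union> A)" for A
  proof -
    have G: "H \<union> A \<subseteq> nsets {1..n} 2"
      using A dense_graph_subset[OF H] by (auto simp: SA_def U_def non_edges_def)
    have ne: "non_edges n (H \<union> A) = U - A" by (auto simp: U_def non_edges_def)
    have p: "is_path n (H \<union> A) [1]" using n by (simp add: is_path_def)
    have "real (bad A) \<le> (11/10) ^ Suc n * (175/176) ^ l * M"
      using few_failures[OF n G ex p, of n l] cUA[OF A]
      by (simp add: bad_def ne M_def Un_assoc)
    also have "(11/10) ^ Suc n * (175/176) ^ l \<le> \<rho>"
    proof -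
      have "(11/10::real) ^ Suc n \<le> exp (1/10) ^ Suc n"
        using exp_ge_add_one_self[of "1/10 :: real"] by (intro power_mono) auto
      moreover have "(175/176::real) ^ l \<le> exp (- 1/176) ^ l"
        using exp_ge_add_one_self[of "- 1/176 :: real"] by (intro power_mono) auto
      ultimately have "(11/10::real) ^ Suc n * (175/176) ^ l \<le> exp (1/10) ^ Suc n * exp (- 1/176) ^ l"
        by (intro mult_mono) auto
      also have "\<dots> = exp ((real n + 1) / 10 - real l / 176)"
        by (simp only: exp_of_nat_mult[symmetric] exp_add[symmetric]) (simp add: field_simps)
      also have "\<dots> \<le> \<rho>" using l by (simp add: \<rho>_def)
      finally show ?thesis .
    qed
    finally show ?thesis by (simp add: M_def mult_right_mono)
  qed
  define X where "X = {A \<in> SA. \<not> expands n (H \<union> A)}"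
  have X: "real (card X) \<le> \<epsilon> * real (N choose k)"
    using expansion_fails_rarely[OF d(1) H _ k(1)[unfolded \<theta>_def]] n
    by (simp add: X_def SA_def U_def N_def \<epsilon>_def conj_assoc)
  have "real (m choose k) * real (card {R. R \<subseteq> U \<and> card R = m \<and> \<not> hamiltonian n (H \<union> R)})
      = (\<Sum>A\<in>SA. real (bad A))"
    using two_step_count[OF finU, of k l "\<lambda>R. \<not> hamiltonian n (H \<union> R)"] km
    by (simp add: l_def SA_def bad_def flip: of_nat_mult)
  also have "\<dots> = (\<Sum>A\<in>X. real (bad A)) + (\<Sum>A\<in>SA - X. real (bad A))"
    using finSA by (subst sum.subset_diff[of X]) (auto simp: X_def)
  also have "\<dots> \<le> (\<Sum>A\<in>X. M) + (\<Sum>A\<in>SA - X. \<rho> * M)"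
    by (intro add_mono sum_mono any good) (auto simp: X_def)
  also have "\<dots> \<le> \<epsilon> * real (N choose k) * M + real (N choose k) * (\<rho> * M)"
  proof (intro add_mono)
    show "(\<Sum>A\<in>X. M) \<le> \<epsilon> * real (N choose k) * M" using X by (simp add: M_def mult_right_mono)
    have "card (SA - X) \<le> N choose k" unfolding cSA[symmetric] using finSA by (intro card_mono) auto
    then show "(\<Sum>A\<in>SA - X. \<rho> * M) \<le> real (N choose k) * (\<rho> * M)"
      by (simp add: M_def \<rho>_def mult_right_mono)
  qed
  also have "\<dots> = (\<epsilon> + \<rho>) * real ((N choose k) * ((N - k) choose l))"
    by (simp add: M_def algebra_simps)
  also have "(N choose k) * ((N - k) choose l) = (N choose m) * (m choose k)"
    using choose_mult[OF km, of N] m(2) by (simp add: l_def N_def U_def)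
  also have "(\<epsilon> + \<rho>) * real ((N choose m) * (m choose k)) = real (m choose k) * ((\<epsilon> + \<rho>) * real (N choose m))"
    by simp
  finally have "real (card {R. R \<subseteq> U \<and> card R = m \<and> \<not> hamiltonian n (H \<union> R)})
      \<le> (\<epsilon> + \<rho>) * real (N choose m)"
    by (rule mult_left_le_imp_le) (use km in simp)
  then show ?thesis by (simp add: U_def N_def \<epsilon>_def \<rho>_def)
qed

lemma prob_random_augmentation:
  assumes "m \<le> card (non_edges n H)"
  shows "measure_pmf.prob (random_augmentation n H m) {G. Q G}
    = real (card {R. R \<subseteq> non_edges n H \<and> card R = m \<and> Q (H \<union> R)}) / real (card (non_edges n H) choose m)"
proof -
  let ?S = "{R. R \<subseteq> non_edges n H \<and> card R = m}"
  have card: "card ?S = card (non_edges n H) choose m" by (simp add: n_subsets finite_non_edges)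
  have fin: "finite ?S" using finite_non_edges by simp
  have "?S \<noteq> {}" using card assms by (metis binomial_eq_0_iff card.empty not_less)
  moreover have "?S \<inter> {R. Q (H \<union> R)} = {R. R \<subseteq> non_edges n H \<and> card R = m \<and> Q (H \<union> R)}" by auto
  ultimately show ?thesis
    unfolding random_augmentation_def using fin card
    by (simp add: measure_pmf_of_set vimage_def)
qed

lemma whp_if_failure_vanishes:
  assumes le: "\<forall>\<^sub>F n in sequentially. measure_pmf.prob (G n) {x. \<not> P n x} \<le> b n"
    and lim: "b \<longlonglongrightarrow> (0 :: real)"
  shows "whp G P"
proof -
  have eq: "measure_pmf.prob (G n) {x. P n x} = 1 - measure_pmf.prob (G n) {x. \<not> P n x}" for n
    using measure_pmf.prob_compl[of "{x. \<not> P n x}" "G n"] by (simp add: Compl_eq_Diff_UNIV[symmetric] Collect_neg_eq)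
  have "(\<lambda>n. measure_pmf.prob (G n) {x. \<not> P n x}) \<longlonglongrightarrow> 0"
    by (rule tendsto_sandwich[OF _ le tendsto_const lim]) simp
  then show ?thesis unfolding whp_def eq by (auto intro!: tendsto_eq_intros)
qed

lemma hamiltonian_whp:
  assumes d: "0 < d" "d \<le> 1/2"
    and ev: "\<forall>\<^sub>F n in sequentially. H n \<in> dense_graphs n d \<and> m n \<le> card (non_edges n (H n)) \<and>
               (30 * ln (inverse d) + 13) * real n \<le> real (m n)"
  shows "whp (\<lambda>n. random_augmentation n (H n) (m n)) hamiltonian"
proof (rule whp_if_failure_vanishes)
  show "(\<lambda>n. real n * exp (- (d * real n / 6)) + exp ((real n + 1) / 10 - (18 * real n - 1) / 176)) \<longlonglongrightarrow> 0"
  proof (rule tendsto_add_zero)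
    show "(\<lambda>n. real n * exp (- (d * real n / 6))) \<longlonglongrightarrow> 0" using d(1) by real_asymp
    show "(\<lambda>n. exp ((real n + 1) / 10 - (18 * real n - 1) / 176)) \<longlonglongrightarrow> 0" by real_asymp
  qed
  show "\<forall>\<^sub>F n in sequentially. measure_pmf.prob (random_augmentation n (H n) (m n)) {G. \<not> hamiltonian n G}
      \<le> real n * exp (- (d * real n / 6)) + exp ((real n + 1) / 10 - (18 * real n - 1) / 176)"
    using ev eventually_ge_at_top[of 10]
  proof eventually_elim
    case (elim n)
    then have "0 < card (non_edges n (H n)) choose m n" by simp
    then show ?case
      using failures_after_sprinkling[OF d, of "H n" n "m n"] elim
      by (simp add: prob_random_augmentation divide_le_eq)
  qed
qed

section \<open>The complete bipartite graph\<close>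

text \<open>
  The successor map along the cycle is injective and sends \<open>J\<close> into \<open>A\<close>.
\<close>

lemma cycle_bounds_sheltered_vertices:
  assumes cyc: "is_cycle E vs" and J: "J \<subseteq> set vs" and A: "finite A"
    and nb: "\<And>v w. v \<in> J \<Longrightarrow> {v, w} \<in> E \<Longrightarrow> w \<in> A"
  shows "card J \<le> card A"
proof -
  define K where "K = {i. i < length vs \<and> vs ! i \<in> J}"
  define next_vertex where "next_vertex i = vs ! (Suc i mod length vs)" for i
  have d: "distinct vs" and len: "3 \<le> length vs" using cyc by (auto simp: is_cycle_def)
  have "(!) vs ` K = J" using J by (force simp: K_def in_set_conv_nth subset_iff)
  then have "card J \<le> card K" using card_image_le[of K "(!) vs"] by (simp add: K_def)
  also have "card K \<le> card A"
  proof (rule card_inj_on_le[OF _ _ A])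
    show "inj_on next_vertex K"
    proof (rule inj_onI)
      fix i j assume ij: "i \<in> K" "j \<in> K" and eq: "next_vertex i = next_vertex j"
      have "Suc i mod length vs = Suc j mod length vs"
        using eq nth_eq_iff_index_eq[OF d] len by (metis mod_less_divisor next_vertex_def
            not_numeral_le_zero zero_less_iff_neq_zero)
      then show "i = j" using ij len
        by (auto simp: K_def mod_Suc split: if_splits)
    qed
    show "next_vertex ` K \<subseteq> A"
      using cyc nb by (auto simp: K_def next_vertex_def is_cycle_def)
  qed
  finally show ?thesis .
qed

definition bipartite :: "nat \<Rightarrow> nat \<Rightarrow> edges" where
  "bipartite a n = cross {1..a} {a<..n}"

definition untouched :: "nat \<Rightarrow> nat \<Rightarrow> edges \<Rightarrow> nat set" where
  "untouched a n R = {v \<in> {a<..n}. \<forall>e\<in>R. v \<notin> e}"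

lemma in_bipartite_iff: "{v, w} \<in> bipartite a n \<longleftrightarrow>
    (v \<in> {1..a} \<and> w \<in> {a<..n}) \<or> (w \<in> {1..a} \<and> v \<in> {a<..n})"
  by (auto simp: bipartite_def cross_def doubleton_eq_iff)

lemma bipartite_subset: "a \<le> n \<Longrightarrow> bipartite a n \<subseteq> nsets {1..n} 2"
  by (auto simp: bipartite_def cross_def nsets_def)

lemma bipartite_dense:
  assumes "d * real n \<le> real a" "d * real n \<le> real (n - a)" "a \<le> n" "1 \<le> n"
  shows "bipartite a n \<in> dense_graphs n d"
proof -
  have "d * real n \<le> real (degree (bipartite a n) v)" if v: "v \<in> {1..n}" for v
  proof (cases "v \<le> a")
    case True
    then have "{w. {v, w} \<in> bipartite a n} = {a<..n}" using v by (auto simp: in_bipartite_iff)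
    then show ?thesis using assms by (simp add: degree_eq_card_neighbours[OF bipartite_subset])
  next
    case False
    then have "{w. {v, w} \<in> bipartite a n} = {1..a}" using v by (auto simp: in_bipartite_iff)
    then show ?thesis using assms by (simp add: degree_eq_card_neighbours[OF bipartite_subset])
  qed
  moreover have "min_degree n (bipartite a n) \<in> degree (bipartite a n) ` {1..n}"
    unfolding min_degree_def using assms by (intro Min_in) auto
  ultimately show ?thesis using bipartite_subset[OF assms(3)] by (auto simp: dense_graphs_def)
qed

lemma many_untouched_not_hamiltonian:
  assumes "a \<le> n" "a < card (untouched a n R)"
  shows "\<not> hamiltonian n (bipartite a n \<union> R)"
proof
  assume "hamiltonian n (bipartite a n \<union> R)"
  then obtain vs where vs: "is_cycle (bipartite a n \<union> R) vs" "set vs = {1..n}"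
    by (auto simp: hamiltonian_def)
  have "card (untouched a n R) \<le> card {1..a}"
  proof (rule cycle_bounds_sheltered_vertices[OF vs(1)])
    show "untouched a n R \<subseteq> set vs" using vs(2) by (auto simp: untouched_def)
    fix v w assume "v \<in> untouched a n R" "{v, w} \<in> bipartite a n \<union> R"
    then show "w \<in> {1..a}" by (auto simp: untouched_def in_bipartite_iff)
  qed simp
  then show False using assms(2) by simp
qed

text \<open>
  A vertex of the larger side has \<open>k\<close> non-neighbours there, and the stars of non-edges at two such vertices share
  exactly one pair, hence the \<open>2 k - 1\<close>.
\<close>

lemma untouched_counts:
  fixes a n :: nat
  defines "U \<equiv> non_edges n (bipartite a n)" and "k \<equiv> n - a - 1"
  assumes a: "a \<le> n" and v: "v \<in> {a<..n}"
  shows "card {R. R \<subseteq> U \<and> card R = m \<and> v \<in> untouched a n R} = (card U - k) choose m"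
    and "u \<in> {a<..n} \<Longrightarrow> u \<noteq> v \<Longrightarrow>
      card {R. R \<subseteq> U \<and> card R = m \<and> u \<in> untouched a n R \<and> v \<in> untouched a n R}
        = (card U - (2 * k - 1)) choose m"
proof -
  define F where "F x = {e \<in> U. x \<in> e}" for x
  have finU: "finite U" by (simp add: U_def finite_non_edges)
  have F: "F x = (\<lambda>w. {x, w}) ` ({a<..n} - {x})" if x: "x \<in> {a<..n}" for x
  proof (intro equalityI subsetI)
    fix e assume "e \<in> F x"
    then have e: "e \<in> nsets {1..n} 2" "e \<notin> bipartite a n" "x \<in> e" by (auto simp: F_def U_def non_edges_def)
    then obtain y z where "e = {y, z}" "y \<noteq> z" by (auto simp: nsets_def card_2_iff)
    then obtain w where w: "e = {x, w}" "w \<noteq> x" "w \<in> {1..n}"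
      using e that[of "if x = y then z else y"] by (auto simp: nsets_def split: if_splits)
    moreover have "w \<in> {a<..n}" using e(2) w x by (auto simp: in_bipartite_iff)
    ultimately show "e \<in> (\<lambda>w. {x, w}) ` ({a<..n} - {x})" by auto
  next
    fix e assume "e \<in> (\<lambda>w. {x, w}) ` ({a<..n} - {x})"
    then obtain w where w: "e = {x, w}" "w \<in> {a<..n}" "w \<noteq> x" by blast
    then have "e \<in> nsets {1..n} 2" using x by (auto simp: nsets_def)
    moreover have "e \<notin> bipartite a n" using w x by (auto simp: in_bipartite_iff)
    ultimately show "e \<in> F x" using w by (auto simp: F_def U_def non_edges_def)
  qed
  have cF: "card (F x) = k" if "x \<in> {a<..n}" for x
  proof -
    have "inj_on (\<lambda>w. {x, w}) ({a<..n} - {x})" by (auto simp: inj_on_def doubleton_eq_iff)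
    then show ?thesis using that by (simp add: F[OF that] card_image k_def)
  qed
  have FU: "F x \<subseteq> U" for x by (auto simp: F_def)
  have iff: "x \<in> untouched a n R \<longleftrightarrow> R \<inter> F x = {}" if "x \<in> {a<..n}" "R \<subseteq> U" for x R
    using that by (auto simp: untouched_def F_def)
  have "{R. R \<subseteq> U \<and> card R = m \<and> v \<in> untouched a n R} = {R. R \<subseteq> U \<and> card R = m \<and> R \<inter> F v = {}}"
    using iff[OF v] by blast
  then show "card {R. R \<subseteq> U \<and> card R = m \<and> v \<in> untouched a n R} = (card U - k) choose m"
    using card_avoiding[OF finU FU, of m v] cF[OF v] by simp
  show "card {R. R \<subseteq> U \<and> card R = m \<and> u \<in> untouched a n R \<and> v \<in> untouched a n R}
        = (card U - (2 * k - 1)) choose m" if u: "u \<in> {a<..n}" and uv: "u \<noteq> v"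
  proof -
    have "{R. R \<subseteq> U \<and> card R = m \<and> u \<in> untouched a n R \<and> v \<in> untouched a n R}
        = {R. R \<subseteq> U \<and> card R = m \<and> R \<inter> (F u \<union> F v) = {}}"
      using iff[OF u] iff[OF v] by blast
    moreover have "F u \<inter> F v = {{u, v}}"
      using u v uv by (auto simp: F[OF u] F[OF v] doubleton_eq_iff)
    then have "card (F u \<union> F v) = 2 * k - 1"
      using card_Un_Int[of "F u" "F v"] cF[OF u] cF[OF v] finite_subset[OF FU finU] by simp
    ultimately show ?thesis using card_avoiding[OF finU, of "F u \<union> F v" m] FU by simp
  qed
qed

text \<open>
  The second moment method, with the edges drawn while at least \<open>M\<close> non-edges away from a given vertex are left: a
  vertex is untouched with probability at least \<open>exp (- k m / M)\<close>, and the covariance of two such events is at most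
  \<open>exp (m / M) - 1\<close>.
\<close>

lemma few_untouched_rare:
  fixes a n m :: nat and M :: real
  defines "U \<equiv> non_edges n (bipartite a n)" and "k \<equiv> n - a - 1"
  assumes a: "a + 2 \<le> n" and M: "0 < M" "M + real k + real m \<le> real (card U)"
    and t: "real a \<le> real (n - a) * exp (- (real k * real m / M))"
  shows "real (card {R. R \<subseteq> U \<and> card R = m \<and> card (untouched a n R) \<le> a})
       * (real (n - a) * exp (- (real k * real m / M)) - real a)\<^sup>2
    \<le> (real (n - a) + (real (n - a))\<^sup>2 * (exp (real m / M) - 1)) * real (card U choose m)"
proof -
  define N where "N = card U"
  define S where "S = {R. R \<subseteq> U \<and> card R = m}"
  define T where "T = real (N choose m)"
  define q where "q = real ((N - k) choose m) / T"
  define p where "p = real ((N - (2 * k - 1)) choose m) / T"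
  have finU: "finite U" by (simp add: U_def finite_non_edges)
  have "m \<le> N" using M by (simp add: N_def)
  then have T: "0 < T" by (simp add: T_def)
  have finS: "finite S" using finU by (simp add: S_def)
  have cS: "real (card S) = T" using finU by (simp add: S_def T_def N_def n_subsets)
  have one: "real (card {R \<in> S. v \<in> untouched a n R}) = q * real (card S)" if "v \<in> {a<..n}" for v
  proof -
    have "{R \<in> S. v \<in> untouched a n R} = {R. R \<subseteq> U \<and> card R = m \<and> v \<in> untouched a n R}"
      by (auto simp: S_def)
    then show ?thesis
      using untouched_counts(1)[of a n v m, folded U_def k_def] that a T by (simp add: cS q_def N_def)
  qed
  have two: "real (card {R \<in> S. u \<in> untouched a n R \<and> v \<in> untouched a n R}) \<le> p * real (card S)"
    if "u \<in> {a<..n}" "v \<in> {a<..n}" "u \<noteq> v" for u v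
  proof -
    have "{R \<in> S. u \<in> untouched a n R \<and> v \<in> untouched a n R}
        = {R. R \<subseteq> U \<and> card R = m \<and> u \<in> untouched a n R \<and> v \<in> untouched a n R}"
      by (auto simp: S_def)
    then show ?thesis
      using untouched_counts(2)[of a n v u m, folded U_def k_def] that a T by (simp add: cS p_def N_def)
  qed
  have "(N - k) choose m \<le> N choose m" by (rule binomial_right_mono) simp
  then have q1: "q \<le> 1" and q0: "0 \<le> q" using T by (auto simp: q_def T_def)
  have p0: "0 \<le> p" using T by (simp add: p_def)
  have lower: "exp (- (real k * real m / M)) \<le> q"
  proof -
    have "T \<le> (1 + real k / M) ^ m * real ((N - k) choose m)"
      unfolding T_def using choose_le_choose_diff[OF M(1), of k m N] M(2) by (simp add: N_def)
    also have "(1 + real k / M) ^ m \<le> exp (real k / M) ^ m"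
      using M(1) exp_ge_add_one_self[of "real k / M"] by (intro power_mono) auto
    also have "exp (real k / M) ^ m = exp (real k * real m / M)"
      by (simp add: exp_of_nat_mult[symmetric] mult.commute)
    finally have "T \<le> exp (real k * real m / M) * real ((N - k) choose m)"
      by (simp add: mult_right_mono)
    then show ?thesis using T by (simp add: q_def exp_minus field_simps)
  qed
  have pair: "p - q\<^sup>2 \<le> exp (real m / M) - 1"
  proof -
    have "1 \<le> k" using a by (simp add: k_def)
    from choose_pair_correlation[OF M(1) this, of m N] M(2)
    have "real ((N - (2 * k - 1)) choose m) * T \<le> (1 + 1 / M) ^ m * (q * T)\<^sup>2"
      using T by (simp add: N_def T_def q_def)
    then have "p \<le> (1 + 1 / M) ^ m * q\<^sup>2"
      using T by (simp add: p_def field_simps power2_eq_square)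
    moreover have "(1 + 1 / M) ^ m \<le> exp (real m / M)"
    proof -
      have "(1 + 1 / M) ^ m \<le> exp (1 / M) ^ m"
        using M(1) exp_ge_add_one_self[of "1 / M"] by (intro power_mono) auto
      then show ?thesis by (simp add: exp_of_nat_mult[symmetric])
    qed
    ultimately have "p \<le> exp (real m / M) * q\<^sup>2"
      by (meson mult_right_mono order.trans zero_le_power2)
    then have "p - q\<^sup>2 \<le> (exp (real m / M) - 1) * q\<^sup>2" by (simp add: algebra_simps)
    also have "\<dots> \<le> (exp (real m / M) - 1) * 1"
      using q0 q1 M(1) by (intro mult_left_mono) (auto simp: power_le_one)
    finally show ?thesis by simp
  qed
  have b: "card {a<..n} = n - a" by simp
  have X: "{v \<in> {a<..n}. v \<in> untouched a n R} = untouched a n R" for R by (auto simp: untouched_def)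
  have mean: "real (n - a) * exp (- (real k * real m / M)) \<le> real (n - a) * q"
    using lower by (rule mult_left_mono) simp
  then have t': "real a \<le> real (n - a) * q"
    and sq: "(real (n - a) * exp (- (real k * real m / M)) - real a)\<^sup>2 \<le> (real (n - a) * q - real a)\<^sup>2"
    using t by - (linarith, rule power_mono, linarith+)
  have "real (card {R \<in> S. card (untouched a n R) \<le> a}) * (real (n - a) * q - real a)\<^sup>2
      \<le> (real (n - a) + (real (n - a))\<^sup>2 * (p - q\<^sup>2)) * real (card S)"
    by (rule chebyshev_count[where I = "{a<..n}" and Y = "\<lambda>R v. v \<in> untouched a n R" and t = "real a",
            unfolded b X of_nat_le_iff, OF finS _ one two q1 p0 t']) simp_all
  also have "\<dots> \<le> (real (n - a) + (real (n - a))\<^sup>2 * (exp (real m / M) - 1)) * real (card S)"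
    using pair by (intro mult_right_mono add_left_mono mult_left_mono) auto
  finally have "real (card {R \<in> S. card (untouched a n R) \<le> a}) * (real (n - a) * q - real a)\<^sup>2
      \<le> (real (n - a) + (real (n - a))\<^sup>2 * (exp (real m / M) - 1)) * T"
    unfolding cS .
  with mult_left_mono[OF sq, of "real (card {R \<in> S. card (untouched a n R) \<le> a})"]
  show ?thesis by (simp add: S_def T_def N_def conj_assoc)
qed

lemma card_non_edges_bipartite_ge:
  "a \<le> n \<Longrightarrow> (n - a) * (n - a - 1) \<le> 2 * card (non_edges n (bipartite a n))"
proof -
  assume "a \<le> n"
  have "nsets {a<..n} 2 \<subseteq> non_edges n (bipartite a n)"
    by (auto simp: non_edges_def nsets_def bipartite_def cross_def)
  then have "card (nsets {a<..n} 2) \<le> card (non_edges n (bipartite a n))"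
    by (rule card_mono[OF finite_non_edges])
  moreover have "2 * ((n - a) choose 2) = (n - a) * (n - a - 1)"
  proof -
    have "even (x * (x - 1))" for x :: nat by (cases x) simp_all
    from dvd_mult_div_cancel[OF this] show ?thesis by (simp only: choose_two)
  qed
  ultimately show ?thesis by simp
qed

text \<open>
  The factor \<open>exp (- (9/10) \<theta>)\<close> in \<open>c\<close> bounds from below the probability that a vertex is untouched, since
  \<open>k m / M \<le> 8/9 \<theta>\<close> for \<open>m < \<theta> n / 3\<close>, \<open>k \<le> n\<close> and \<open>M = 3/8 n\<^sup>2\<close>. The bound is of order \<open>1 / n\<close>.
\<close>

lemma not_hamiltonian_rate:
  fixes d \<theta> :: real and n m :: nat
  defines "a \<equiv> nat \<lceil>d * real n\<rceil>" and "c \<equiv> 9/10 * exp (- (9/10 * \<theta>)) - d"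
  assumes d: "0 < d" "d \<le> 1/10" and th: "0 < \<theta>"
    and n: "4 \<le> n" "2 < c * real n"
      "3/8 * (real n)\<^sup>2 + real n + \<theta> * real n / 3 \<le> (9/10 * real n - 1) * (9/10 * real n - 2) / 2"
    and m: "m \<le> card (non_edges n (bipartite a n))" "real m < \<theta> * real n / 3"
  shows "measure_pmf.prob (random_augmentation n (bipartite a n) m) {G. hamiltonian n G}
    \<le> (real n + (real n)\<^sup>2 * (exp (8/9 * \<theta> / real n) - 1)) / (c * real n - 2)\<^sup>2"
proof -
  define U where "U = non_edges n (bipartite a n)"
  define k where "k = n - a - 1"
  \<comment> \<open>\<open>M\<close> is a lower bound for the number of non-edges that remain while the \<open>m\<close> edges are drawn; the main
      term of that number is at least \<open>0.405 n\<^sup>2\<close>.\<close>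
  define M where "M = 3/8 * (real n)\<^sup>2"
  define T where "T = real (card U choose m)"
  have a: "d * real n \<le> real a" "real a \<le> d * real n + 1"
    using d by (auto simp: a_def of_nat_ceiling)
  have "d * real n \<le> 1/10 * real n" using d by (intro mult_right_mono) auto
  then have b: "9/10 * real n - 1 \<le> real n - real a" "a + 2 \<le> n" using a n(1) by linarith+
  then have an: "a \<le> n" "real (n - a) = real n - real a" "real k = real n - real a - 1"
    by (auto simp: k_def of_nat_diff)
  have M0: "0 < M" using n by (simp add: M_def)
  have "(9/10 * real n - 1) * (9/10 * real n - 2) \<le> (real n - real a) * (real n - real a - 1)"
    using b n(1) by (intro mult_mono) auto
  also have "\<dots> = real ((n - a) * (n - a - 1))" by (simp only: of_nat_mult k_def[symmetric] an)
  also have "\<dots> \<le> real (2 * card U)"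
    using card_non_edges_bipartite_ge[OF an(1)] unfolding U_def by (simp only: of_nat_le_iff)
  finally have MU: "M + real k + real m \<le> real (card U)" using n(3) m(2) an(3) by (simp add: M_def)
  have mM: "real m / M \<le> 8/9 * \<theta> / real n"
  proof -
    have "real m / M \<le> (\<theta> * real n / 3) / M" using m(2) M0 by (intro divide_right_mono) auto
    then show ?thesis using n(1) by (simp add: M_def power2_eq_square field_simps)
  qed
  have "real k * (real m / M) \<le> real n * (8/9 * \<theta> / real n)"
    using mM an(3) M0 by (intro mult_mono) auto
  also have "\<dots> \<le> 9/10 * \<theta>" using th n(1) by simp
  finally have g: "exp (- (9/10 * \<theta>)) \<le> exp (- (real k * real m / M))" by simp
  have "(9/10 * real n - 1) * exp (- (9/10 * \<theta>)) \<le> real (n - a) * exp (- (real k * real m / M))"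
    using b(1) g n(1) by (intro mult_mono) (auto simp: an(2))
  moreover have "(9/10 * real n - 1) * exp (- (9/10 * \<theta>)) = c * real n + d * real n - exp (- (9/10 * \<theta>))"
    by (simp add: c_def algebra_simps)
  moreover have "exp (- (9/10 * \<theta>)) \<le> 1" using th by simp
  ultimately have gap: "c * real n - 2 \<le> real (n - a) * exp (- (real k * real m / M)) - real a"
    using a(2) by linarith
  define z where "z = real (n - a) * exp (- (real k * real m / M)) - real a"
  define bad where "bad = real (card {R. R \<subseteq> U \<and> card R = m \<and> card (untouched a n R) \<le> a})"
  have T0: "0 < T" using m(1) by (simp add: T_def U_def)
  have "bad * (c * real n - 2)\<^sup>2 \<le> bad * z\<^sup>2"
    unfolding z_def by (rule mult_left_mono[OF power_mono[OF gap]]) (use n(2) in \<open>auto simp: bad_def\<close>)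
  also have "\<dots> \<le> (real (n - a) + (real (n - a))\<^sup>2 * (exp (real m / M) - 1)) * T"
    unfolding bad_def z_def T_def
    by (rule few_untouched_rare[OF b(2) M0, folded U_def k_def, OF MU]) (use gap n(2) in linarith)
  also have "\<dots> \<le> (real n + (real n)\<^sup>2 * (exp (8/9 * \<theta> / real n) - 1)) * T"
    using mM M0 T0 by (intro mult_right_mono add_mono mult_mono power_mono diff_mono) auto
  finally have main: "bad / T \<le> (real n + (real n)\<^sup>2 * (exp (8/9 * \<theta> / real n) - 1)) / (c * real n - 2)\<^sup>2"
    using T0 n(2) by (simp add: field_simps)
  have "{R. R \<subseteq> U \<and> card R = m \<and> hamiltonian n (bipartite a n \<union> R)}
      \<subseteq> {R. R \<subseteq> U \<and> card R = m \<and> card (untouched a n R) \<le> a}"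
    using many_untouched_not_hamiltonian[OF an(1)] by (auto simp: not_less[symmetric])
  then have "real (card {R. R \<subseteq> U \<and> card R = m \<and> hamiltonian n (bipartite a n \<union> R)}) \<le> bad"
    unfolding bad_def by (intro of_nat_mono card_mono) (auto simp: U_def finite_non_edges)
  then have "measure_pmf.prob (random_augmentation n (bipartite a n) m) {G. hamiltonian n G} \<le> bad / T"
    unfolding prob_random_augmentation[OF m(1)] T_def U_def by (intro divide_right_mono) auto
  with main show ?thesis by linarith
qed

lemma not_hamiltonian_whp:
  fixes d \<theta> :: real
  assumes d: "0 < d" "d \<le> 1/10" and th: "\<theta> = ln (inverse d)"
  shows "\<exists>H. (\<forall>\<^sub>F n in sequentially. H n \<in> dense_graphs n d) \<and>
    (\<forall>m. (\<forall>\<^sub>F n in sequentially. m n \<le> card (non_edges n (H n)) \<and> real (m n) < \<theta> * real n / 3)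
       \<longrightarrow> whp (\<lambda>n. random_augmentation n (H n) (m n)) (\<lambda>n G. \<not> hamiltonian n G))"
proof -
  define a where "a n = nat \<lceil>d * real n\<rceil>" for n
  define c where "c = 9/10 * exp (- (9/10 * \<theta>)) - d"
  have "ln (2 ^ 3) \<le> ln (inverse d)" using d by (subst ln_le_cancel_iff) (auto simp: field_simps)
  then have th2: "2 \<le> \<theta>" using ln2_ge_two_thirds ln_realpow[of 2 3] by (simp add: th)
  \<comment> \<open>The expected fraction of untouched vertices is at least about \<open>(9/10) d powr (9/10)\<close>, which exceeds
      \<open>d\<close> because \<open>d\<close> is small; \<open>c\<close> is the difference.\<close>
  have "0 < c"
  proof -
    have "exp (- (9/10 * \<theta>)) * exp (- (1/10 * \<theta>)) = exp (- \<theta>)" by (simp add: exp_add[symmetric])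
    moreover have "exp (- \<theta>) = d" using d by (simp add: th exp_minus)
    moreover have "10/9 < exp (1/10 * \<theta>)" using exp_ge_add_one_self[of "1/10 * \<theta>"] th2 by linarith
    then have "exp (- (1/10 * \<theta>)) < 9/10" by (simp add: exp_minus field_simps)
    from mult_strict_left_mono[OF this, of "exp (- (9/10 * \<theta>))"]
    have "exp (- (9/10 * \<theta>)) * exp (- (1/10 * \<theta>)) < exp (- (9/10 * \<theta>)) * (9/10)" by simp
    ultimately show ?thesis by (simp add: c_def)
  qed
  have dense: "\<forall>\<^sub>F n in sequentially. bipartite (a n) n \<in> dense_graphs n d"
    using eventually_ge_at_top[of 2]
  proof eventually_elim
    case (elim n)
    have "d * real n \<le> 1/10 * real n" using d by (intro mult_right_mono) auto
    moreover have "d * real n \<le> real (a n)" "real (a n) \<le> d * real n + 1"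
      using d by (auto simp: a_def of_nat_ceiling)
    ultimately have "a n \<le> n" "d * real n \<le> real n - real (a n)" using elim by linarith+
    with \<open>d * real n \<le> real (a n)\<close> show ?case using elim by (intro bipartite_dense) (simp_all add: of_nat_diff)
  qed
  have "whp (\<lambda>n. random_augmentation n (bipartite (a n) n) (m n)) (\<lambda>n G. \<not> hamiltonian n G)"
    if ev: "\<forall>\<^sub>F n in sequentially. m n \<le> card (non_edges n (bipartite (a n) n)) \<and> real (m n) < \<theta> * real n / 3"
    for m
  proof (rule whp_if_failure_vanishes)
    show "(\<lambda>n. (real n + (real n)\<^sup>2 * (exp (8/9 * \<theta> / real n) - 1)) / (c * real n - 2)\<^sup>2) \<longlonglongrightarrow> 0"
      using \<open>0 < c\<close> th2 by real_asymp
    have "\<forall>\<^sub>F n in sequentially. 2 < c * real n" using \<open>0 < c\<close> by real_asymp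
    moreover have "\<forall>\<^sub>F n in sequentially. 3/8 * (real n)\<^sup>2 + real n + \<theta> * real n / 3
        \<le> (9/10 * real n - 1) * (9/10 * real n - 2) / 2"
      by real_asymp
    ultimately show "\<forall>\<^sub>F n in sequentially.
        measure_pmf.prob (random_augmentation n (bipartite (a n) n) (m n)) {G. \<not> \<not> hamiltonian n G}
        \<le> (real n + (real n)\<^sup>2 * (exp (8/9 * \<theta> / real n) - 1)) / (c * real n - 2)\<^sup>2"
      using ev eventually_ge_at_top[of 4]
    proof eventually_elim
      case (elim n)
      then show ?case
        using not_hamiltonian_rate[OF d, of \<theta> n "m n"] th2 by (simp add: a_def c_def)
    qed
  qed
  with dense show ?thesis by (intro exI[of _ "\<lambda>n. bipartite (a n) n"]) blast
qed

theorem theorem1: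
  fixes d \<theta> :: real
  assumes "0 < d" and "d \<le> 1/2" and "\<theta> = ln (inverse d)"
  shows "(\<forall>(H :: nat \<Rightarrow> edges) (m :: nat \<Rightarrow> nat).
            (\<forall>\<^sub>F n in sequentially. H n \<in> dense_graphs n d \<and>
               m n \<le> card (non_edges n (H n)) \<and>
               real (m n) \<ge> (30 * \<theta> + 13) * real n)
            \<longrightarrow> whp (\<lambda>n. random_augmentation n (H n) (m n)) (\<lambda>n G. hamiltonian n G))
       \<and> (d \<le> 1/10 \<longrightarrow>
           (\<exists>H :: nat \<Rightarrow> edges.
              (\<forall>\<^sub>F n in sequentially. H n \<in> dense_graphs n d) \<and>
              (\<forall>m :: nat \<Rightarrow> nat.
                 (\<forall>\<^sub>F n in sequentially. m n \<le> card (non_edges n (H n)) \<and>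
                    real (m n) < \<theta> * real n / 3)
                 \<longrightarrow> whp (\<lambda>n. random_augmentation n (H n) (m n)) (\<lambda>n G. \<not> hamiltonian n G))))"
proof (intro conjI allI impI)
  fix H :: "nat \<Rightarrow> edges" and m :: "nat \<Rightarrow> nat"
  assume "\<forall>\<^sub>F n in sequentially. H n \<in> dense_graphs n d \<and> m n \<le> card (non_edges n (H n)) \<and>
            real (m n) \<ge> (30 * \<theta> + 13) * real n"
  then show "whp (\<lambda>n. random_augmentation n (H n) (m n)) (\<lambda>n G. hamiltonian n G)"
    using hamiltonian_whp[OF assms(1,2), of H m] by (simp add: assms(3))
next
  assume "d \<le> 1/10"
  from not_hamiltonian_whp[OF assms(1) this assms(3)]
  show "\<exists>H :: nat \<Rightarrow> edges.
          (\<forall>\<^sub>F n in sequentially. H n \<in> dense_graphs n d) \<and>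
          (\<forall>m :: nat \<Rightarrow> nat.
             (\<forall>\<^sub>F n in sequentially. m n \<le> card (non_edges n (H n)) \<and>
                real (m n) < \<theta> * real n / 3)
             \<longrightarrow> whp (\<lambda>n. random_augmentation n (H n) (m n)) (\<lambda>n G. \<not> hamiltonian n G))"
    by blast
qed


end
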